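(* There exist sequences $(\lambda_k^+)_{k\in\mathbb N}$ and $(\lambda_k^-)_{k\in\mathbb N}$ of eigenvalues of $A$ and a constant $C>0$ such that $\operatorname{Im}\lambda_k^\pm\sim\pm k\pi$ as $k\to\infty$ and $$-\frac{C}{|\operatorname{Im}\lambda_k^\pm|^3}\le\operatorname{Re}\lambda_k^\pm<0,\qquad k\in\mathbb N.$$ In particular, $$\limsup_{|s|\to\infty}\frac{\|R(is,A)\|}{|s|^3}>0,$$ where $s$ ranges over $\mathbb R$.
   Context: Notation: $\mathbb N=\{1,2,3,\dots\}$; $a_k\sim b_k$ means $a_k/b_k\to1$; $R(\lambda,A)=(\lambda-A)^{-1}$ for $\lambda\in\mathbb C\setminus\sigma(A)$, and $\|\cdot\|$ is the operator norm on the space $Z$ below. The spectrum $\sigma(A)$ of the operator $A$ below is contained in $\{\lambda\in\mathbb C:\operatorname{Re}\lambda<0\}$, so $R(is,A)$ is defined for all $s\in\mathbb R$. Let $\Omega_-=(-1,0)\times(0,1)$, $\Omega_+=(0,1)\times(0,1)$ and $\Gamma=\{(0,y):0\le y\le1\}=\partial\Omega_-\cap\partial\Omega_+$. All function spaces are complex. Let $H^1_\Gamma(\Omega_\mp)$ be the set of functions in $H^1(\Omega_\mp)$ whose trace vanishes on $\partial\Omega_\mp\setminus\Gamma$, endowed with the (equivalent, Poincaré) norm $\|u\|=\|\nabla u\|_{L^2}$. Let $Z$ be the Hilbert space $H^1_\Gamma(\Omega_-)\times L^2(\Omega_-)\times L^2(\Omega_+)$ with its natural inner product. Let $Z_0$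 be the set of all $(u,v,w)\in Z$ with $\Delta u\in L^2(\Omega_-)$, $v\in H^1_\Gamma(\Omega_-)$, $w\in H^1_\Gamma(\Omega_+)$ and $\Delta w\in L^2(\Omega_+)$. Define $A(u,v,w)=(v,\Delta u,\Delta w)$ on the domain $$D(A)=\{(u,v,w)\in Z_0: v|_\Gamma=w|_\Gamma \text{ and } u_x|_\Gamma=w_x|_\Gamma\},$$ where the coupling conditions along $\Gamma$ are understood in the sense of traces; the condition $u_x|_\Gamma=w_x|_\Gamma$ is understood in the sense of weak normal traces, i.e. $\int_{\Omega_-}(\nabla u\cdot\nabla\varphi+\varphi\,\Delta u)+\int_{\Omega_+}(\nabla w\cdot\nabla\varphi+\varphi\,\Delta w)=0$ for all $\varphi\in H^1_0((-1,1)\times(0,1))$. *)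

theory Defs
  imports "HOL-Analysis.Analysis"
begin

text \<open>
  Elements of function spaces on \<open>\<Omega>\<close> are represented by Borel functions defined on the whole
  space, of which only the values on \<open>\<Omega>\<close> matter; functions agreeing a.e. on \<open>\<Omega>\<close>
  represent the same element.
\<close>

section \<open>Smooth functions and test functions\<close>

definition pd :: "'a::euclidean_space \<Rightarrow> ('a \<Rightarrow> complex) \<Rightarrow> 'a \<Rightarrow> complex" where
  "pd b f z = frechet_derivative f (at z) b"

definition smooth :: "('a::euclidean_space \<Rightarrow> complex) \<Rightarrow> bool" where
  "smooth f \<longleftrightarrow> (\<forall>bs \<in> lists Basis. \<forall>z. foldr pd bs f differentiable (at z))"

definition test_fun :: "'a::euclidean_space set \<Rightarrow> ('a \<Rightarrow> complex) \<Rightarrow> bool" where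
  "test_fun \<Omega> \<phi> \<longleftrightarrow>
     smooth \<phi> \<and> compact (closure {z. \<phi> z \<noteq> 0}) \<and> closure {z. \<phi> z \<noteq> 0} \<subseteq> \<Omega>"

definition laplacian :: "('a::euclidean_space \<Rightarrow> complex) \<Rightarrow> 'a \<Rightarrow> complex" where
  "laplacian \<phi> z = (\<Sum>b\<in>Basis. pd b (pd b \<phi>) z)"

section \<open>Lebesgue and Sobolev spaces\<close>

definition L2 :: "'a::euclidean_space set \<Rightarrow> ('a \<Rightarrow> complex) set" where
  "L2 \<Omega> = {f. set_borel_measurable lborel \<Omega> f \<and>
              set_integrable lborel \<Omega> (\<lambda>z. (cmod (f z))\<^sup>2)}"

definition l2norm :: "'a::euclidean_space set \<Rightarrow> ('a \<Rightarrow> complex) \<Rightarrow> real" where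
  "l2norm \<Omega> f = sqrt (LINT z:\<Omega>|lborel. (cmod (f z))\<^sup>2)"

definition ae_eq ::
  "'a::euclidean_space set \<Rightarrow> ('a \<Rightarrow> complex) \<Rightarrow> ('a \<Rightarrow> complex) \<Rightarrow> bool" where
  "ae_eq \<Omega> f g \<longleftrightarrow> (AE z in lborel. z \<in> \<Omega> \<longrightarrow> f z = g z)"

definition has_weak_pd ::
  "'a::euclidean_space set \<Rightarrow> 'a \<Rightarrow> ('a \<Rightarrow> complex) \<Rightarrow> ('a \<Rightarrow> complex) \<Rightarrow> bool" where
  "has_weak_pd \<Omega> b f g \<longleftrightarrow> g \<in> L2 \<Omega> \<and>
     (\<forall>\<phi>. test_fun \<Omega> \<phi> \<longrightarrow>
        (LINT z:\<Omega>|lborel. f z * pd b \<phi> z) = - (LINT z:\<Omega>|lborel. g z * \<phi> z))"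

text \<open>Weak derivatives and weak Laplacians are unique up to null sets, so the choice of a representative
  is immaterial.\<close>

definition wpd :: "'a::euclidean_space set \<Rightarrow> 'a \<Rightarrow> ('a \<Rightarrow> complex) \<Rightarrow> 'a \<Rightarrow> complex" where
  "wpd \<Omega> b f = (SOME g. has_weak_pd \<Omega> b f g)"

definition has_weak_laplacian ::
  "'a::euclidean_space set \<Rightarrow> ('a \<Rightarrow> complex) \<Rightarrow> ('a \<Rightarrow> complex) \<Rightarrow> bool" where
  "has_weak_laplacian \<Omega> f g \<longleftrightarrow> g \<in> L2 \<Omega> \<and>
     (\<forall>\<phi>. test_fun \<Omega> \<phi> \<longrightarrow>
        (LINT z:\<Omega>|lborel. f z * laplacian \<phi> z) = (LINT z:\<Omega>|lborel. g z * \<phi> z))"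

definition wlap :: "'a::euclidean_space set \<Rightarrow> ('a \<Rightarrow> complex) \<Rightarrow> 'a \<Rightarrow> complex" where
  "wlap \<Omega> f = (SOME g. has_weak_laplacian \<Omega> f g)"

definition H1 :: "'a::euclidean_space set \<Rightarrow> ('a \<Rightarrow> complex) set" where
  "H1 \<Omega> = {f \<in> L2 \<Omega>. \<forall>b\<in>Basis. \<exists>g. has_weak_pd \<Omega> b f g}"

definition gradnorm :: "'a::euclidean_space set \<Rightarrow> ('a \<Rightarrow> complex) \<Rightarrow> real" where
  "gradnorm \<Omega> f = sqrt (\<Sum>b\<in>Basis. (l2norm \<Omega> (wpd \<Omega> b f))\<^sup>2)"

definition h1norm :: "'a::euclidean_space set \<Rightarrow> ('a \<Rightarrow> complex) \<Rightarrow> real" where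
  "h1norm \<Omega> f = sqrt ((l2norm \<Omega> f)\<^sup>2 + (gradnorm \<Omega> f)\<^sup>2)"

definition H10 :: "'a::euclidean_space set \<Rightarrow> ('a \<Rightarrow> complex) set" where
  "H10 \<Omega> = {f \<in> H1 \<Omega>. \<exists>\<phi>. (\<forall>n. test_fun \<Omega> (\<phi> n)) \<and>
              (\<lambda>n::nat. h1norm \<Omega> (\<lambda>z. \<phi> n z - f z)) \<longlonglongrightarrow> 0}"

text \<open>
  The trace on the boundary segment from \<open>p\<close> to \<open>q\<close>: the continuous extension to \<open>H1 \<Omega>\<close> of the
  restriction map for functions that are smooth up to the boundary, with values in \<open>L2\<close> of the
  segment. All segments used have length 1, so \<open>linepath p q\<close> is the arc length parametrization,
  and \<open>g t\<close> is the value of the trace at \<open>linepath p q t\<close>.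
\<close>

definition has_trace ::
  "'a::euclidean_space set \<Rightarrow> 'a \<Rightarrow> 'a \<Rightarrow> ('a \<Rightarrow> complex) \<Rightarrow> (real \<Rightarrow> complex) \<Rightarrow> bool" where
  "has_trace \<Omega> p q u g \<longleftrightarrow> u \<in> H1 \<Omega> \<and> g \<in> L2 {0<..<1} \<and>
     (\<exists>\<phi>. (\<forall>n. smooth (\<phi> n)) \<and>
        (\<lambda>n::nat. h1norm \<Omega> (\<lambda>z. \<phi> n z - u z)) \<longlonglongrightarrow> 0 \<and>
        (\<lambda>n. l2norm {0<..<1} (\<lambda>t. \<phi> n (linepath p q t) - g t)) \<longlonglongrightarrow> 0)"

section \<open>The coupled system\<close>

type_synonym plane = "real \<times> real"
type_synonym state = "(plane \<Rightarrow> complex) \<times> (plane \<Rightarrow> complex) \<times> (plane \<Rightarrow> complex)"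

definition \<Omega>m :: "plane set" where "\<Omega>m = {-1<..<0} \<times> {0<..<1}"
definition \<Omega>p :: "plane set" where "\<Omega>p = {0<..<1} \<times> {0<..<1}"
definition \<Omega>full :: "plane set" where "\<Omega>full = {-1<..<1} \<times> {0<..<1}"

text \<open>The three edges of each square other than \<open>\<Gamma>\<close>, which is the segment from \<open>(0,0)\<close> to
  \<open>(0,1)\<close>.\<close>

definition edges_m :: "(plane \<times> plane) set" where
  "edges_m = {((-1,0),(0,0)), ((-1,0),(-1,1)), ((-1,1),(0,1))}"

definition edges_p :: "(plane \<times> plane) set" where
  "edges_p = {((0,0),(1,0)), ((1,0),(1,1)), ((0,1),(1,1))}"

definition H1\<Gamma>m :: "(plane \<Rightarrow> complex) set" where
  "H1\<Gamma>m = {u \<in> H1 \<Omega>m. \<forall>(p,q)\<in>edges_m. has_trace \<Omega>m p q u (\<lambda>_. 0)}"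

definition H1\<Gamma>p :: "(plane \<Rightarrow> complex) set" where
  "H1\<Gamma>p = {u \<in> H1 \<Omega>p. \<forall>(p,q)\<in>edges_p. has_trace \<Omega>p p q u (\<lambda>_. 0)}"

definition Z :: "state set" where
  "Z = H1\<Gamma>m \<times> L2 \<Omega>m \<times> L2 \<Omega>p"

fun zeq :: "state \<Rightarrow> state \<Rightarrow> bool" where
  "zeq (u, v, w) (u', v', w') \<longleftrightarrow> ae_eq \<Omega>m u u' \<and> ae_eq \<Omega>m v v' \<and> ae_eq \<Omega>p w w'"

fun znorm :: "state \<Rightarrow> real" where
  "znorm (u, v, w) = sqrt ((gradnorm \<Omega>m u)\<^sup>2 + (l2norm \<Omega>m v)\<^sup>2 + (l2norm \<Omega>p w)\<^sup>2)"

definition zzero :: state where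
  "zzero = (\<lambda>_. 0, \<lambda>_. 0, \<lambda>_. 0)"

fun zscale :: "complex \<Rightarrow> state \<Rightarrow> state" where
  "zscale c (u, v, w) = (\<lambda>z. c * u z, \<lambda>z. c * v z, \<lambda>z. c * w z)"

fun zdiff :: "state \<Rightarrow> state \<Rightarrow> state" where
  "zdiff (u, v, w) (u', v', w') = (\<lambda>z. u z - u' z, \<lambda>z. v z - v' z, \<lambda>z. w z - w' z)"

definition Z0 :: "state set" where
  "Z0 = {(u, v, w) \<in> Z. (\<exists>g. has_weak_laplacian \<Omega>m u g) \<and> v \<in> H1\<Gamma>m \<and>
           w \<in> H1\<Gamma>p \<and> (\<exists>g. has_weak_laplacian \<Omega>p w g)}"

definition green_integral ::
  "plane set \<Rightarrow> (plane \<Rightarrow> complex) \<Rightarrow> (plane \<Rightarrow> complex) \<Rightarrow> complex" where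
  "green_integral \<Omega> u \<phi> =
     (LINT z:\<Omega>|lborel. (\<Sum>b\<in>Basis. wpd \<Omega> b u z * wpd \<Omega>full b \<phi> z) + \<phi> z * wlap \<Omega> u z)"

definition same_trace_\<Gamma> :: "(plane \<Rightarrow> complex) \<Rightarrow> (plane \<Rightarrow> complex) \<Rightarrow> bool" where
  "same_trace_\<Gamma> v w \<longleftrightarrow>
     (\<exists>g. has_trace \<Omega>m (0,0) (0,1) v g \<and> has_trace \<Omega>p (0,0) (0,1) w g)"

definition same_normal_trace_\<Gamma> :: "(plane \<Rightarrow> complex) \<Rightarrow> (plane \<Rightarrow> complex) \<Rightarrow> bool" where
  "same_normal_trace_\<Gamma> u w \<longleftrightarrow>
     (\<forall>\<phi>\<in>H10 \<Omega>full. green_integral \<Omega>m u \<phi> + green_integral \<Omega>p w \<phi> = 0)"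

definition A_dom :: "state set" where
  "A_dom = {(u, v, w) \<in> Z0. same_trace_\<Gamma> v w \<and> same_normal_trace_\<Gamma> u w}"

fun A_op :: "state \<Rightarrow> state" where
  "A_op (u, v, w) = (v, wlap \<Omega>m u, wlap \<Omega>p w)"

definition A_eigenvalue :: "complex \<Rightarrow> bool" where
  "A_eigenvalue \<mu> \<longleftrightarrow> (\<exists>x\<in>A_dom. \<not> zeq x zzero \<and> zeq (A_op x) (zscale \<mu> x))"

text \<open>The resolvent \<open>R(\<mu>, A)\<close> as the graph of the inverse of \<open>\<mu> - A\<close>, that is, the set of pairs
  \<open>(F, x)\<close> with \<open>(\<mu> - A) x = F\<close>; and the operator norm on \<open>Z\<close> of an operator given by its
  graph.\<close>

definition A_resolvent :: "complex \<Rightarrow> (state \<times> state) set" where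
  "A_resolvent \<mu> = {(F, x). F \<in> Z \<and> x \<in> A_dom \<and> zeq (zdiff (zscale \<mu> x) (A_op x)) F}"

definition opnorm :: "(state \<times> state) set \<Rightarrow> ennreal" where
  "opnorm T = (SUP (F, x) \<in> {(F, x) \<in> T. znorm F \<le> 1}. ennreal (znorm x))"

end

theory Submission
  imports Defs
begin

text \<open>
  Separation of variables reduces the eigenvalue problem to a transcendental equation. The functions
  \<open>u = d sin (\<alpha> (x + 1)) sin (n \<pi> y)\<close> on the left square and \<open>w = c sin (\<beta> (1 - x)) sin (n \<pi> y)\<close> on
  the right square vanish on the outer edges. With \<open>v = \<lambda> u\<close>, the equation \<open>A (u, v, w) = \<lambda> (u, v, w)\<close>
  says \<open>\<alpha>\<^sup>2 + n\<^sup>2 \<pi>\<^sup>2 = - \<lambda>\<^sup>2\<close> and \<open>\<beta>\<^sup>2 + n\<^sup>2 \<pi>\<^sup>2 = - \<lambda>\<close>, while the coupling along the interface says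
  \<open>\<lambda> d sin \<alpha> = c sin \<beta>\<close> and \<open>d \<alpha> cos \<alpha> = - c \<beta> cos \<beta>\<close>. The coupling has a nontrivial solution
  \<open>(d, c)\<close> when \<open>\<alpha> cos \<alpha> sin \<beta> + \<lambda> \<beta> sin \<alpha> cos \<beta> = 0\<close>; the locale \<open>characteristic_root\<close> collects
  these equations.

  Eigenvalues close to the imaginary axis appear when the horizontal number \<open>\<alpha>\<close> stays near \<open>\<pi>\<close> while
  the tangential frequency \<open>n = k\<close> tends to infinity: the heat component then decays within distance
  of order \<open>1 / k\<close> of the interface and dissipates very little. Indeed \<open>\<lambda> \<approx> \<i> k \<pi>\<close>, hence \<open>\<beta> \<approx> \<i> k \<pi>\<close>
  and \<open>tan \<beta> \<rightarrow> \<i>\<close>, and for \<open>\<alpha> = \<pi> + \<delta>\<close> the equation becomes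
  \<open>tan \<delta> = - \<alpha> tan \<beta> / (\<lambda> \<beta>) \<approx> \<i> / (\<pi> k\<^sup>2)\<close>. As \<open>\<lambda>\<^sup>2 = - \<alpha>\<^sup>2 - k\<^sup>2 \<pi>\<^sup>2\<close>, this gives
  \<open>Re \<lambda> Im \<lambda> = - Re \<alpha> Im \<alpha> \<approx> - 1 / k\<^sup>2\<close>, so that \<open>Re \<lambda>\<close> is negative and of order \<open>\<bar>Im \<lambda>\<bar>\<close> to the power
  \<open>-3\<close>. A solution is found by Brouwer's theorem: after the substitution \<open>\<delta> = \<zeta> / k\<^sup>2\<close> the equation is
  a fixed point problem for a map that converges to the constant \<open>\<i> / \<pi>\<close> uniformly on a ball around
  \<open>\<i> / \<pi>\<close> (\<open>fixmap_tendsto\<close>, \<open>characteristic_roots_exist\<close>). Complex conjugation yields the second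
  sequence.

  An eigenvector \<open>x\<close> for \<open>\<lambda>\<close> satisfies \<open>(\<i> Im \<lambda> - A) x = - Re \<lambda> x\<close>, so the resolvent at \<open>\<i> Im \<lambda>\<close> has norm
  at least \<open>1 / \<bar>Re \<lambda>\<bar>\<close> (\<open>opnorm_resolvent_ge\<close>); the bound on \<open>Re \<lambda>\<close> turns this into the lower bound on
  the limit superior.

  It remains to see that these explicit smooth functions belong to the domain of \<open>A\<close>, where derivatives
  are arbitrary representatives of weak derivatives. The fundamental lemma of the calculus of
  variations identifies those with the classical derivatives almost everywhere. The condition
  on normal traces quantifies over \<open>H10 \<Omega>full\<close>; both Green integrals are continuous in the \<open>H1\<close> norm, so
  by density it suffices to consider test functions, for which the fundamental theorem of calculus
  on the two rectangles leaves only interface terms (\<open>same_normal_trace_smooth\<close>).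
\<close>


(*INTRO*)
section \<open>Closure properties of smooth functions\<close>

lemma pd_eqI: "(f has_derivative f') (at z) \<Longrightarrow> pd b f z = f' b"
  unfolding pd_def by (metis frechet_derivative_at)

text \<open>
  Smoothness is the greatest invariant: it suffices to exhibit a class of differentiable functions that
  is stable under the partial derivatives.
\<close>

lemma smooth_coinduct:
  assumes "f \<in> S"
    and diff: "\<And>g z. g \<in> S \<Longrightarrow> g differentiable (at z)"
    and pd: "\<And>g b. g \<in> S \<Longrightarrow> b \<in> Basis \<Longrightarrow> pd b g \<in> S"
  shows "smooth f"
proof -
  have "foldr pd bs f \<in> S" if "bs \<in> lists Basis" for bs
    using that by (induction bs) (auto simp: assms)
  with diff show ?thesis by (auto simp: smooth_def)
qed

lemma smooth_differentiable: "smooth f \<Longrightarrow> f differentiable (at z)"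
  unfolding smooth_def by (metis foldr_Nil id_apply lists.Nil)

lemma smooth_pd:
  assumes "smooth f" "b \<in> Basis" shows "smooth (pd b f)"
  unfolding smooth_def
proof (intro ballI allI)
  fix bs z assume "bs \<in> lists (Basis :: 'a set)"
  then have "bs @ [b] \<in> lists Basis" using assms(2) by auto
  then have "foldr pd (bs @ [b]) f differentiable (at z)"
    using assms(1) unfolding smooth_def by blast
  then show "foldr pd bs (pd b f) differentiable (at z)" by simp
qed

lemma smooth_has_derivative:
  "smooth f \<Longrightarrow> (f has_derivative frechet_derivative f (at z)) (at z)"
  using smooth_differentiable frechet_derivative_works by blast

lemma smooth_continuous_on: "smooth f \<Longrightarrow> continuous_on S f"
  by (meson continuous_at_imp_continuous_on differentiable_imp_continuous_within smooth_differentiable)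

text \<open>
  The classical function that vanishes to infinite order at 0, together with its quotients by powers of
  its argument. The powers are included because differentiation then stays within the family.
\<close>

definition flat :: "nat \<Rightarrow> real \<Rightarrow> real" where
  "flat k t = (if t \<le> 0 then 0 else exp (- 1 / t) / t ^ k)"

text \<open>
  After the substitution \<open>x = 1 / t\<close> this is the decay of \<open>x ^ k * exp (- x)\<close>.
\<close>

lemma flat_tendsto_0: "(flat k \<longlongrightarrow> 0) (at 0)"
proof -
  have "((\<lambda>t::real. (1/t) ^ k / exp (1/t)) \<longlongrightarrow> 0) (at_right 0)"
    using filterlim_compose[OF tendsto_power_div_exp_0[of k] filterlim_inverse_at_top_right]
    by (simp add: inverse_eq_divide)
  then have "(flat k \<longlongrightarrow> 0) (at_right 0)"
    by (rule Lim_transform_eventually)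
      (auto simp: flat_def eventually_at_right_field power_divide exp_minus field_simps intro: exI[of _ 1])
  moreover have "(flat k \<longlongrightarrow> 0) (at_left 0)"
    by (rule tendsto_eventually) (auto simp: flat_def eventually_at_left_field intro: exI[of _ "-1"])
  ultimately show ?thesis by (simp add: filterlim_split_at)
qed

lemma flat_has_derivative:
  "(flat k has_real_derivative flat (k + 2) t - real k * flat (k + 1) t) (at t)"
proof (cases "t = 0")
  case True
  have "((\<lambda>h. (flat k (0 + h) - flat k 0) / h) \<longlongrightarrow> 0) (at 0)"
    by (rule Lim_transform_eventually[OF flat_tendsto_0[of "k + 1"]])
      (auto simp: flat_def eventually_at_filter)
  then show ?thesis by (simp add: True DERIV_def flat_def)
next
  case False
  show ?thesis
  proof (cases "t < 0")
    case True
    have "((\<lambda>_. 0) has_real_derivative 0) (at t)" by simp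
    then have "(flat k has_real_derivative 0) (at t)"
      by (rule has_field_derivative_transform_within_open[where S = "{..<0}"]) (auto simp: True flat_def)
    with True show ?thesis by (simp add: flat_def)
  next
    case False
    with \<open>t \<noteq> 0\<close> have t: "t > 0" by simp
    have "((\<lambda>t. exp (- 1 / t) / t ^ k) has_real_derivative
       exp (- 1 / t) / t ^ (k + 2) - real k * (exp (- 1 / t) / t ^ (k + 1))) (at t)"
    proof (cases k)
      case (Suc m)
      have "((\<lambda>t. exp (- 1 / t) / t ^ Suc m) has_real_derivative
        (exp (- 1 / t) * (1 / t\<^sup>2) * t ^ Suc m - exp (- 1 / t) * (real (Suc m) * t ^ m)) / (t ^ Suc m * t ^ Suc m)) (at t)"
      proof (rule DERIV_divide)
        show "((\<lambda>t. exp (- 1 / t)) has_real_derivative exp (- 1 / t) * (1 / t\<^sup>2)) (at t)"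
          using t by (auto intro!: derivative_eq_intros simp: power2_eq_square)
        show "((\<lambda>t. t ^ Suc m) has_real_derivative real (Suc m) * t ^ m) (at t)"
          using DERIV_pow[of "Suc m" t] by simp
      qed (use t in simp)
      also have "(exp (- 1 / t) * (1 / t\<^sup>2) * t ^ Suc m - exp (- 1 / t) * (real (Suc m) * t ^ m)) / (t ^ Suc m * t ^ Suc m)
        = exp (- 1 / t) / t ^ (k + 2) - real k * (exp (- 1 / t) / t ^ (k + 1))"
        using t Suc by (simp add: field_simps power2_eq_square)
      finally show ?thesis by (simp add: Suc)
    qed (use t in \<open>auto intro!: derivative_eq_intros simp: power2_eq_square\<close>)
    then have "((\<lambda>t. exp (- 1 / t) / t ^ k) has_real_derivative
       flat (k + 2) t - real k * flat (k + 1) t) (at t)"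
      using t by (simp add: flat_def)
    then show ?thesis
      by (rule has_field_derivative_transform_within_open[where S = "{0<..}"]) (auto simp: t flat_def)
  qed
qed

text \<open>
  An algebra of functions, large enough for bump functions and for trigonometric functions, that is
  closed under partial derivatives by the sum, product and chain rules. Containing all smooth
  functions to begin with, it makes smoothness itself closed under the operations listed.
\<close>

inductive smooth_alg :: "('a::euclidean_space \<Rightarrow> complex) \<Rightarrow> bool" where
  base: "smooth f \<Longrightarrow> smooth_alg f"
| const: "smooth_alg (\<lambda>_. c)"
| lin: "smooth_alg (\<lambda>z. of_real (z \<bullet> v))"
| flat: "smooth_alg (\<lambda>z. of_real (flat k (z \<bullet> v + c)))"
| add: "smooth_alg f \<Longrightarrow> smooth_alg g \<Longrightarrow> smooth_alg (\<lambda>z. f z + g z)"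
| mult: "smooth_alg f \<Longrightarrow> smooth_alg g \<Longrightarrow> smooth_alg (\<lambda>z. f z * g z)"
| exp: "smooth_alg f \<Longrightarrow> smooth_alg (\<lambda>z. exp (f z))"

lemma smooth_alg_closed:
  "smooth_alg f \<Longrightarrow> (\<forall>z. f differentiable (at z)) \<and> (\<forall>b\<in>Basis. smooth_alg (pd b f))"
proof (induction rule: smooth_alg.induct)
  case (base f)
  then show ?case using smooth_differentiable smooth_pd smooth_alg.base by blast
next
  case (const c)
  have "((\<lambda>_. c) has_derivative (\<lambda>_. 0)) (at z)" for z :: 'a by simp
  from pd_eqI[OF this] have "pd b (\<lambda>_::'a. c) = (\<lambda>_. 0)" for b by auto
  then show ?case by (auto intro: smooth_alg.const)
next
  case (lin v)
  have d: "((\<lambda>z. of_real (z \<bullet> v) :: complex) has_derivative (\<lambda>h. of_real (h \<bullet> v))) (at z)" for z :: 'a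
    by (auto intro!: derivative_eq_intros)
  from pd_eqI[OF d] have "pd b (\<lambda>z. of_real (z \<bullet> v)) = (\<lambda>_. of_real (b \<bullet> v))" for b by auto
  with d show ?case by (auto intro: smooth_alg.const simp: differentiable_def)
next
  case (flat k v c)
  have d: "((\<lambda>z. of_real (flat k (z \<bullet> v + c)) :: complex) has_derivative
     (\<lambda>h. of_real ((h \<bullet> v) * (flat (k + 2) (z \<bullet> v + c) - real k * flat (k + 1) (z \<bullet> v + c))))) (at z)" for z :: 'a
  proof -
    have 1: "((\<lambda>z. z \<bullet> v + c) has_derivative (\<lambda>h. h \<bullet> v)) (at z)"
      by (auto intro!: derivative_eq_intros)
    from has_derivative_compose[OF 1 flat_has_derivative[of k, THEN has_field_derivative_imp_has_derivative]]
    show ?thesis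
      by (intro has_derivative_of_real) (simp add: mult.commute)
  qed
  have "pd b (\<lambda>z. of_real (flat k (z \<bullet> v + c)))
     = (\<lambda>z. of_real (b \<bullet> v) * (of_real (flat (k + 2) (z \<bullet> v + c)) + (- of_real (real k)) * of_real (flat (k + 1) (z \<bullet> v + c))))" for b
    using pd_eqI[OF d] by (auto simp: algebra_simps)
  moreover have "smooth_alg (\<lambda>z. of_real (b \<bullet> v) * (of_real (flat (k + 2) (z \<bullet> v + c)) + (- of_real (real k)) * of_real (flat (k + 1) (z \<bullet> v + c))))" for b
    by (intro smooth_alg.intros(2,4,5,6))
  ultimately have "smooth_alg (pd b (\<lambda>z. of_real (flat k (z \<bullet> v + c))))" for b
    by simp
  with d show ?case unfolding differentiable_def by blast
next
  case (add f g)
  have d: "((\<lambda>z. f z + g z) has_derivative (\<lambda>h. frechet_derivative f (at z) h + frechet_derivative g (at z) h)) (at z)" for z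
    using add by (intro has_derivative_add) (auto simp: frechet_derivative_works)
  have "pd b (\<lambda>z. f z + g z) = (\<lambda>z. pd b f z + pd b g z)" for b
    using pd_eqI[OF d] by (auto simp: pd_def)
  with d add show ?case by (auto simp: differentiable_def intro: smooth_alg.add)
next
  case (mult f g)
  have d: "((\<lambda>z. f z * g z) has_derivative (\<lambda>h. f z * frechet_derivative g (at z) h + frechet_derivative f (at z) h * g z)) (at z)" for z
    using mult by (intro has_derivative_mult) (auto simp: frechet_derivative_works)
  have "pd b (\<lambda>z. f z * g z) = (\<lambda>z. f z * pd b g z + pd b f z * g z)" for b
    using pd_eqI[OF d] by (auto simp: pd_def)
  with d mult show ?case by (auto simp: differentiable_def intro!: smooth_alg.intros(5,6))
next
  case (exp f)
  have d: "((\<lambda>z. exp (f z)) has_derivative (\<lambda>h. exp (f z) * frechet_derivative f (at z) h)) (at z)" for z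
  proof -
    have "(f has_derivative frechet_derivative f (at z)) (at z)"
      using exp by (auto simp: frechet_derivative_works)
    from has_derivative_compose[OF this DERIV_exp[THEN has_field_derivative_imp_has_derivative]]
    show ?thesis by simp
  qed
  have "pd b (\<lambda>z. exp (f z)) = (\<lambda>z. exp (f z) * pd b f z)" for b
    using pd_eqI[OF d] by (auto simp: pd_def)
  with d exp show ?case by (auto simp: differentiable_def intro!: smooth_alg.intros(6,7))
qed

lemma smooth_alg_smooth: "smooth_alg f \<Longrightarrow> smooth f"
  by (rule smooth_coinduct[of _ "Collect smooth_alg"]) (auto simp: smooth_alg_closed)

lemma smooth_const: "smooth (\<lambda>_. c)"
  and smooth_lin: "smooth (\<lambda>z. of_real (z \<bullet> v))"
  and smooth_flat: "smooth (\<lambda>z. of_real (flat k (z \<bullet> v + t)))"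
  by (auto intro!: smooth_alg_smooth smooth_alg.intros(2-4))

lemma smooth_add: "smooth f \<Longrightarrow> smooth g \<Longrightarrow> smooth (\<lambda>z. f z + g z)"
  and smooth_mult: "smooth f \<Longrightarrow> smooth g \<Longrightarrow> smooth (\<lambda>z. f z * g z)"
  and smooth_exp: "smooth f \<Longrightarrow> smooth (\<lambda>z. exp (f z))"
  by (auto intro!: smooth_alg_smooth intro: smooth_alg.intros(1,5-7))

lemma smooth_diff: "smooth f \<Longrightarrow> smooth g \<Longrightarrow> smooth (\<lambda>z. f z - g z)"
  using smooth_add[of f "\<lambda>z. (-1) * g z"] smooth_mult[OF smooth_const[of "-1"], of g] by simp

lemma smooth_prod: "finite I \<Longrightarrow> (\<And>i. i \<in> I \<Longrightarrow> smooth (f i)) \<Longrightarrow> smooth (\<lambda>z. \<Prod>i\<in>I. f i z)"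
  by (induction I rule: finite_induct) (auto intro: smooth_const smooth_mult)

lemma smooth_sin:
  assumes "smooth f" shows "smooth (\<lambda>z. sin (f z))"
proof -
  have "(\<lambda>z. sin (f z)) = (\<lambda>z. (1 / (2 * \<i>)) * (exp (\<i> * f z) - exp ((- \<i>) * f z)))"
    by (auto simp: sin_exp_eq)
  moreover have "smooth (\<lambda>z. (1 / (2 * \<i>)) * (exp (\<i> * f z) - exp ((- \<i>) * f z)))"
    by (intro smooth_mult smooth_const smooth_diff smooth_exp assms)
  ultimately show ?thesis by simp
qed

lemma pd_mult:
  assumes "smooth f" "smooth g"
  shows "pd b (\<lambda>z. f z * g z) z = f z * pd b g z + pd b f z * g z"
  using pd_eqI[OF has_derivative_mult[OF smooth_has_derivative smooth_has_derivative], OF assms]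
  by (simp add: pd_def)

section \<open>Test functions and the fundamental lemma of the calculus of variations\<close>

lemma flat_nonneg: "flat k t \<ge> 0" and flat_pos_iff: "flat k t > 0 \<longleftrightarrow> t > 0"
  by (auto simp: flat_def)

lemma flat_not_neg: "\<not> flat k t < 0"
  by (simp add: not_less flat_nonneg)

lemma continuous_flat: "isCont (flat k) t"
  using flat_has_derivative DERIV_isCont by blast

lemma test_fun_subset: "test_fun S \<phi> \<Longrightarrow> S \<subseteq> T \<Longrightarrow> test_fun T \<phi>"
  by (auto simp: test_fun_def)

lemma test_funI:
  assumes "smooth \<phi>" "compact K" "K \<subseteq> S" "\<And>z. \<phi> z \<noteq> 0 \<Longrightarrow> z \<in> K"
  shows "test_fun S \<phi>"
proof -
  have "closure {z. \<phi> z \<noteq> 0} \<subseteq> K"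
    using assms by (intro closure_minimal) (auto intro: compact_imp_closed)
  moreover from this have "compact (closure {z. \<phi> z \<noteq> 0})"
    using compact_Int_closed[OF assms(2) closed_closure[of "{z. \<phi> z \<noteq> 0}"]] by (simp add: inf.absorb2)
  ultimately show ?thesis using assms by (auto simp: test_fun_def)
qed

lemma test_funE:
  assumes "test_fun S \<phi>"
  obtains K where "smooth \<phi>" "compact K" "K \<subseteq> S" "\<And>z. z \<notin> K \<Longrightarrow> \<phi> z = 0"
proof (rule that)
  show "smooth \<phi>" "compact (closure {z. \<phi> z \<noteq> 0})" "closure {z. \<phi> z \<noteq> 0} \<subseteq> S"
    using assms by (simp_all add: test_fun_def)
  show "\<phi> z = 0" if "z \<notin> closure {z. \<phi> z \<noteq> 0}" for z
    using that closure_subset[of "{z. \<phi> z \<noteq> 0}"] by blast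
qed

lemma test_fun_mult:
  assumes "smooth f" "test_fun S \<phi>" shows "test_fun S (\<lambda>z. f z * \<phi> z)"
proof -
  obtain K where K: "smooth \<phi>" "compact K" "K \<subseteq> S" "\<And>z. z \<notin> K \<Longrightarrow> \<phi> z = 0"
    using test_funE[OF assms(2)] by metis
  show ?thesis
    using K(4) by (intro test_funI[OF smooth_mult[OF assms(1) K(1)] K(2,3)]) force
qed

lemma test_fun_pd:
  assumes "test_fun S \<phi>" "b \<in> Basis" shows "test_fun S (pd b \<phi>)"
  using assms(1)
proof (rule test_funE)
  fix K assume *: "smooth \<phi>" "compact K" "K \<subseteq> S" "\<And>z. z \<notin> K \<Longrightarrow> \<phi> z = 0"
  show ?thesis
  proof (rule test_funI[OF smooth_pd[OF *(1) assms(2)] *(2,3)])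
    fix z assume nz: "pd b \<phi> z \<noteq> 0"
    show "z \<in> K"
    proof (rule ccontr)
      assume z: "z \<notin> K"
      have "((\<lambda>_. 0) has_derivative (\<lambda>_. 0)) (at z)" by simp
      then have "(\<phi> has_derivative (\<lambda>_. 0)) (at z)"
        by (rule has_derivative_transform_within_open[where s = "- K"])
          (use z * in \<open>auto simp: compact_imp_closed open_Compl\<close>)
      from pd_eqI[OF this] nz show False by simp
    qed
  qed
qed

text \<open>
  Bump functions: if \<open>H \<ge> 0\<close> is smooth and positive exactly on a slightly smaller box, then
  \<open>1 - exp (- n H)\<close> is smooth, lies between 0 and 1 and tends to 1 where \<open>H > 0\<close>. Letting the box grow
  with \<open>n\<close> keeps each support compact inside the given box and still exhausts it in the limit.
\<close>

lemma test_fun_tendsto_indicator_box: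
  fixes a b :: "'a::euclidean_space"
  obtains \<phi> :: "nat \<Rightarrow> 'a \<Rightarrow> complex"
  where "\<And>n. test_fun (box a b) (\<phi> n)" "\<And>n z. cmod (\<phi> n z) \<le> 1"
    "\<And>z. (\<lambda>n. \<phi> n z) \<longlonglongrightarrow> indicator (box a b) z"
proof
  define H where "H e z = (\<Prod>i\<in>Basis. flat 0 (z \<bullet> i - (a \<bullet> i + e)) * flat 0 ((b \<bullet> i - e) - z \<bullet> i))"
    for e :: real and z :: 'a
  \<comment> \<open>the shrinking by \<open>1 / Suc n\<close> provides the compact support\<close>
  define \<phi> :: "nat \<Rightarrow> 'a \<Rightarrow> complex"
    where "\<phi> n z = 1 - of_real (exp (- (real n * H (1 / real (Suc n)) z)))" for n z
  have shrunk: "z \<in> box (a + e *\<^sub>R One) (b - e *\<^sub>R One) \<longleftrightarrow> (\<forall>i\<in>Basis. a \<bullet> i + e < z \<bullet> i \<and> z \<bullet> i < b \<bullet> i - e)"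
    "z \<in> cbox (a + e *\<^sub>R One) (b - e *\<^sub>R One) \<longleftrightarrow> (\<forall>i\<in>Basis. a \<bullet> i + e \<le> z \<bullet> i \<and> z \<bullet> i \<le> b \<bullet> i - e)"
    for e and z :: 'a
    by (simp_all add: mem_box inner_add_left inner_diff_left)
  have shrunk_subset: "cbox (a + e *\<^sub>R One) (b - e *\<^sub>R One) \<subseteq> box a b" if "e > 0" for e
  proof
    fix z assume z: "z \<in> cbox (a + e *\<^sub>R One) (b - e *\<^sub>R One)"
    show "z \<in> box a b"
      unfolding mem_box
    proof
      fix i :: 'a assume "i \<in> Basis"
      with z have "a \<bullet> i + e \<le> z \<bullet> i" "z \<bullet> i \<le> b \<bullet> i - e" unfolding shrunk by blast+
      with \<open>e > 0\<close> show "a \<bullet> i < z \<bullet> i \<and> z \<bullet> i < b \<bullet> i" by linarith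
    qed
  qed
  have H0: "H e z \<ge> 0" for e z
    unfolding H_def by (intro prod_nonneg) (simp add: flat_nonneg)
  have Hpos: "H e z > 0 \<longleftrightarrow> z \<in> box (a + e *\<^sub>R One) (b - e *\<^sub>R One)" for e z
  proof -
    define f where "f i = flat 0 (z \<bullet> i - (a \<bullet> i + e)) * flat 0 ((b \<bullet> i - e) - z \<bullet> i)" for i
    have f0: "f i \<ge> 0" for i unfolding f_def by (intro mult_nonneg_nonneg flat_nonneg)
    have "H e z > 0 \<longleftrightarrow> (\<forall>i\<in>Basis. f i > 0)"
    proof
      assume pos: "H e z > 0"
      show "\<forall>i\<in>Basis. f i > 0"
      proof
        fix i :: 'a assume "i \<in> Basis"
        moreover have "prod f Basis \<noteq> 0" using pos unfolding H_def f_def[symmetric] by (rule less_imp_neq[symmetric])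
        ultimately have "f i \<noteq> 0" by (simp add: prod_zero_iff)
        with f0[of i] show "f i > 0" by simp
      qed
    next
      assume "\<forall>i\<in>Basis. f i > 0"
      then show "H e z > 0" unfolding H_def f_def[symmetric] by (intro prod_pos) blast
    qed
    also have "\<dots> \<longleftrightarrow> (\<forall>i\<in>Basis. a \<bullet> i + e < z \<bullet> i \<and> z \<bullet> i < b \<bullet> i - e)"
      by (auto simp: f_def zero_less_mult_iff flat_not_neg flat_pos_iff)
    also have "\<dots> \<longleftrightarrow> z \<in> box (a + e *\<^sub>R One) (b - e *\<^sub>R One)"
      by (simp add: shrunk)
    finally show ?thesis .
  qed
  show "cmod (\<phi> n z) \<le> 1" for n z
  proof -
    have "\<phi> n z = of_real (1 - exp (- (real n * H (1 / real (Suc n)) z)))" by (simp add: \<phi>_def)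
    moreover have "\<bar>1 - exp (- (real n * H (1 / real (Suc n)) z))\<bar> \<le> 1"
      using H0[of "1 / real (Suc n)" z] by (simp add: abs_le_iff)
    ultimately show ?thesis by (simp only: norm_of_real)
  qed
  show "test_fun (box a b) (\<phi> n)" for n
  proof (rule test_funI)
    define e where "e = 1 / real (Suc n)"
    have "\<phi> n = (\<lambda>z. 1 - exp ((- of_nat n) *
        (\<Prod>i\<in>Basis. of_real (flat 0 (z \<bullet> i + (- (a \<bullet> i + e)))) * of_real (flat 0 (z \<bullet> (- i) + (b \<bullet> i - e))))))"
      by (auto simp: \<phi>_def H_def e_def exp_of_real[symmetric] algebra_simps)
    moreover have "smooth (\<lambda>z::'a. 1 - exp ((- of_nat n) *
        (\<Prod>i\<in>Basis. of_real (flat 0 (z \<bullet> i + (- (a \<bullet> i + e)))) * of_real (flat 0 (z \<bullet> (- i) + (b \<bullet> i - e))))))"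
      by (intro smooth_diff smooth_const smooth_exp smooth_mult smooth_prod smooth_flat finite_Basis)
    ultimately show "smooth (\<phi> n)" by simp
    show "compact (cbox (a + e *\<^sub>R One) (b - e *\<^sub>R One))" by (rule compact_cbox)
    have "e > 0" by (simp add: e_def)
    then show "cbox (a + e *\<^sub>R One) (b - e *\<^sub>R One) \<subseteq> box a b"
      by (rule shrunk_subset)
    show "z \<in> cbox (a + e *\<^sub>R One) (b - e *\<^sub>R One)" if "\<phi> n z \<noteq> 0" for z
    proof -
      have "H e z \<noteq> 0" using that by (auto simp: \<phi>_def e_def)
      with H0[of e z] have "H e z > 0" by linarith
      then show ?thesis using Hpos box_subset_cbox by blast
    qed
  qed
  show "(\<lambda>n. \<phi> n z) \<longlonglongrightarrow> indicator (box a b) z" for z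
  proof (cases "z \<in> box a b")
    case True
    have "(\<lambda>n. H (1 / real (Suc n)) z) \<longlonglongrightarrow> H 0 z"
      unfolding H_def
      by (intro tendsto_intros isCont_tendsto_compose[OF continuous_flat] LIMSEQ_Suc[OF lim_1_over_n])
    moreover have "H 0 z > 0" using True by (simp add: Hpos)
    ultimately have "filterlim (\<lambda>n. H (1 / real (Suc n)) z * real n) at_top sequentially"
      by (rule filterlim_tendsto_pos_mult_at_top) (rule filterlim_real_sequentially)
    then have "filterlim (\<lambda>n. - (real n * H (1 / real (Suc n)) z)) at_bot sequentially"
      by (simp add: filterlim_uminus_at_bot mult.commute)
    then have "(\<lambda>n. exp (- (real n * H (1 / real (Suc n)) z))) \<longlonglongrightarrow> 0"
      by (rule filterlim_compose[OF exp_at_bot])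
    then have "(\<lambda>n. \<phi> n z) \<longlonglongrightarrow> 1 - of_real 0"
      unfolding \<phi>_def by (intro tendsto_intros)
    with True show ?thesis by simp
  next
    case False
    have "\<phi> n z = 0" for n
    proof -
      define e where "e = 1 / real (Suc n)"
      have "e > 0" by (simp add: e_def)
      then have "box (a + e *\<^sub>R One) (b - e *\<^sub>R One) \<subseteq> box a b"
        using shrunk_subset box_subset_cbox by blast
      then have "\<not> H e z > 0" using False Hpos by blast
      with H0[of e z] have "H e z = 0" by linarith
      then show ?thesis by (simp add: \<phi>_def e_def)
    qed
    with False show ?thesis by simp
  qed
qed

text \<open>
  Boxes form a generator of the Borel sets that is stable under intersection, so the integral
  vanishes over every Borel set, and a density with this property is zero almost everywhere.
\<close>

lemma set_integral_box_zero_imp_AE_zero: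
  fixes g :: "'a::euclidean_space \<Rightarrow> complex"
  assumes int: "set_integrable lborel (box p q) g"
    and zero: "\<And>a b. box a b \<subseteq> box p q \<Longrightarrow> (LINT z:box a b|lborel. g z) = 0"
  shows "AE z in lborel. z \<in> box p q \<longrightarrow> g z = 0"
proof -
  let ?g = "\<lambda>z. indicator (box p q) z *\<^sub>R g z"
  have ig: "integrable lborel ?g" using int by (simp add: set_integrable_def)
  have si: "set_integrable lborel A ?g" if "A \<in> sets borel" for A
    using that integrable_mult_indicator[OF _ ig, of A] unfolding set_integrable_def by simp
  have null: "(LINT z:A|lborel. ?g z) = 0" if A0: "A \<in> sets lborel" for A
  proof -
    have eq: "sets borel = sigma_sets UNIV (range (\<lambda>(a, b). box a b :: 'a set))"
      by (subst borel_eq_box) (simp add: sets_measure_of)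
    have stable: "Int_stable (range (\<lambda>(a, b). box a b :: 'a set))"
      by (auto simp: Int_stable_def box_Int_box)
    have sub: "range (\<lambda>(a, b). box a b :: 'a set) \<subseteq> Pow UNIV" by simp
    have "A \<in> sigma_sets UNIV (range (\<lambda>(a, b). box a b :: 'a set))"
      using A0 eq by simp
    from stable sub this show ?thesis
    proof (induct A rule: sigma_sets_induct_disjoint)
      case (basic A)
      then obtain a b where A: "A = box a b" by auto
      obtain c d where cd: "box a b \<inter> box p q = box c d" by (auto simp: box_Int_box)
      have "(LINT z:A|lborel. ?g z) = (LINT z:box c d|lborel. g z)"
        unfolding set_lebesgue_integral_def A cd[symmetric] by (simp add: indicator_inter_arith)
      with zero[of c d] cd show ?case by auto
    next
      case empty
      show ?case by (simp add: set_lebesgue_integral_def)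
    next
      case (compl A)
      then have A: "A \<in> sets borel" unfolding eq by blast
      then have A': "- A \<in> sets borel" by (rule borel_comp)
      have "(LINT z:A \<union> -A|lborel. ?g z) = (LINT z:A|lborel. ?g z) + (LINT z:-A|lborel. ?g z)"
        by (rule set_integral_Un[OF _ si[OF A] si[OF A']]) simp
      moreover have "(LINT z:A \<union> -A|lborel. ?g z) = 0"
        using zero[OF order_refl] by (simp add: set_lebesgue_integral_def)
      ultimately show ?case using compl(2) by (simp add: Compl_eq_Diff_UNIV)
    next
      case (union F)
      then have F: "F i \<in> sets lborel" for i unfolding eq sets_lborel by blast
      then have "set_integrable lborel (\<Union>i. F i) ?g" by (intro si) auto
      then have "(LINT z:(\<Union>i. F i)|lborel. ?g z) = (\<Sum>i. LINT z:F i|lborel. ?g z)"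
        using F union(1) by (intro lebesgue_integral_countable_add) (simp_all add: disjoint_family_on_def)
      with union(3) show ?case by simp
    qed
  qed
  from sigma_finite_measure.density_zero[OF sigma_finite_lborel ig null] show ?thesis by (auto simp: indicator_def elim!: eventually_mono split: if_splits)
qed

text \<open>
  Dominated convergence along the bump functions turns the hypothesis into vanishing integrals over
  all boxes.
\<close>

lemma fundamental_lemma_of_variations:
  fixes g :: "'a::euclidean_space \<Rightarrow> complex"
  assumes int: "set_integrable lborel (box p q) g"
    and zero: "\<And>\<phi>. test_fun (box p q) \<phi> \<Longrightarrow> (LINT z:box p q|lborel. g z * \<phi> z) = 0"
  shows "AE z in lborel. z \<in> box p q \<longrightarrow> g z = 0"
proof (rule set_integral_box_zero_imp_AE_zero[OF int])
  fix a b :: 'a assume sub: "box a b \<subseteq> box p q"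
  obtain \<phi> :: "nat \<Rightarrow> 'a \<Rightarrow> complex" where \<phi>: "\<And>n. test_fun (box a b) (\<phi> n)" "\<And>n z. cmod (\<phi> n z) \<le> 1"
    "\<And>z. (\<lambda>n. \<phi> n z) \<longlonglongrightarrow> indicator (box a b) z"
    using test_fun_tendsto_indicator_box[of a b] by metis
  let ?g = "\<lambda>z. indicator (box p q) z *\<^sub>R g z"
  have ig: "integrable lborel ?g" using int by (simp add: set_integrable_def)
  have meas: "\<phi> n \<in> borel_measurable borel" for n
    using \<phi>(1)[of n] by (auto simp: test_fun_def intro!: borel_measurable_continuous_onI smooth_continuous_on)
  have "(\<lambda>n. LINT z|lborel. ?g z * \<phi> n z) \<longlonglongrightarrow> (LINT z|lborel. ?g z * indicator (box a b) z)"
  proof (rule integral_dominated_convergence[where w = "\<lambda>z. cmod (?g z)"])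
    show "(\<lambda>z. ?g z * indicator (box a b) z) \<in> borel_measurable lborel"
      using ig by (intro borel_measurable_times) auto
    show "(\<lambda>z. ?g z * \<phi> n z) \<in> borel_measurable lborel" for n
      using ig meas by (intro borel_measurable_times) auto
    show "AE z in lborel. norm (?g z * \<phi> n z) \<le> cmod (?g z)" for n
      using \<phi>(2)[of n] by (auto simp: norm_mult indicator_def intro!: always_eventually mult_right_le_one_le)
    show "AE z in lborel. (\<lambda>n. ?g z * \<phi> n z) \<longlonglongrightarrow> ?g z * indicator (box a b) z"
      using \<phi>(3) by (auto intro!: tendsto_intros)
    show "integrable lborel (\<lambda>z. cmod (?g z))" using ig by (rule integrable_norm)
  qed
  moreover have "(LINT z|lborel. ?g z * \<phi> n z) = 0" for n
    using zero[OF test_fun_subset[OF \<phi>(1) sub], of n] by (simp add: set_lebesgue_integral_def)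
  ultimately have "(LINT z|lborel. ?g z * indicator (box a b) z) = 0"
    by (simp only: LIMSEQ_const_iff)
  moreover have "?g z * indicator (box a b) z = indicator (box a b) z *\<^sub>R g z" for z
    using sub by (auto simp: indicator_def)
  ultimately show "(LINT z:box a b|lborel. g z) = 0"
    by (simp add: set_lebesgue_integral_def)
qed

section \<open>Weak derivatives of smooth functions\<close>

lemma L2_integrable:
  assumes "f \<in> L2 S" "S \<in> sets borel" "emeasure lborel S < \<infinity>"
  shows "set_integrable lborel S f"
proof -
  have c: "set_integrable lborel S (\<lambda>_. 1 :: real)"
    using assms by (auto simp: set_integrable_def)
  have "set_integrable lborel S (\<lambda>z. 1 + (cmod (f z))\<^sup>2)"
    using set_integral_add(1)[OF c, of "\<lambda>z. (cmod (f z))\<^sup>2"] assms(1) by (simp add: L2_def)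
  then show ?thesis
  proof (rule set_integrable_bound)
    show "set_borel_measurable lborel S f" using assms(1) by (simp add: L2_def)
    have "cmod (f z) \<le> 1 + (cmod (f z))\<^sup>2" for z
    proof -
      have "0 \<le> (cmod (f z) - 1/2)\<^sup>2" by simp
      then show ?thesis by (simp add: power2_eq_square algebra_simps)
    qed
    then show "AE z in lborel. z \<in> S \<longrightarrow> norm (f z) \<le> norm (1 + (cmod (f z))\<^sup>2)"
      by (intro always_eventually) (auto intro: order_trans)
  qed
qed

lemma integrable_mult_bounded:
  fixes f c :: "'a::euclidean_space \<Rightarrow> complex"
  assumes f: "set_integrable lborel S f"
    and c: "c \<in> borel_measurable borel" and bd: "\<And>z. z \<in> S \<Longrightarrow> cmod (c z) \<le> B"
  shows "set_integrable lborel S (\<lambda>z. f z * c z)"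
proof -
  have "set_integrable lborel S (\<lambda>z. complex_of_real B * f z)"
    using f by simp
  then show ?thesis
  proof (rule set_integrable_bound)
    have "(\<lambda>z. indicator S z *\<^sub>R f z) \<in> borel_measurable lborel"
      using f by (auto simp: set_integrable_def)
    then have "(\<lambda>z. (indicator S z *\<^sub>R f z) * c z) \<in> borel_measurable lborel"
      using c by (intro borel_measurable_times) auto
    then show "set_borel_measurable lborel S (\<lambda>z. f z * c z)"
      by (simp add: set_borel_measurable_def)
    show "AE z in lborel. z \<in> S \<longrightarrow> norm (f z * c z) \<le> norm (complex_of_real B * f z)"
    proof (intro always_eventually allI impI)
      fix z assume "z \<in> S"
      from bd[OF this] show "norm (f z * c z) \<le> norm (complex_of_real B * f z)"
        by (auto simp: norm_mult mult.commute[of "cmod (f z)"] intro!: mult_right_mono order_trans[OF _ abs_ge_self])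
    qed
  qed
qed

lemma continuous_bounded_on_box:
  fixes f :: "'a::euclidean_space \<Rightarrow> complex"
  assumes "continuous_on UNIV f"
  obtains B where "B \<ge> 0" "\<And>z. z \<in> box p q \<Longrightarrow> cmod (f z) \<le> B"
proof -
  have "compact (f ` cbox p q)"
    using assms by (intro compact_continuous_image) (auto intro: continuous_on_subset)
  then obtain B where B: "\<And>z. z \<in> cbox p q \<Longrightarrow> cmod (f z) \<le> B"
    using compact_imp_bounded bounded_iff by (metis image_eqI)
  show thesis
    by (rule that[of "max 0 B"]) (use B box_subset_cbox[of p q] in \<open>auto simp: le_max_iff_disj\<close>)
qed

lemma emeasure_box_finite: "emeasure lborel (box p q :: 'a::euclidean_space set) < \<infinity>"
  by (simp add: emeasure_lborel_box_eq)

lemma continuous_set_integrable_box: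
  fixes f :: "'a::euclidean_space \<Rightarrow> complex"
  assumes "continuous_on UNIV f"
  shows "set_integrable lborel (box p q) f"
proof -
  obtain B where "\<And>z. z \<in> box p q \<Longrightarrow> cmod (f z) \<le> B"
    using continuous_bounded_on_box[OF assms] by metis
  moreover have "set_integrable lborel (box p q) (\<lambda>_. 1 :: complex)"
    using emeasure_box_finite[of p q] by (auto simp: set_integrable_def)
  ultimately show ?thesis
    using integrable_mult_bounded[of "box p q" "\<lambda>_. 1" f B] assms
    by (simp add: borel_measurable_continuous_onI)
qed

lemma continuous_L2_box:
  fixes f :: "'a::euclidean_space \<Rightarrow> complex"
  assumes "continuous_on UNIV f"
  shows "f \<in> L2 (box p q)"
proof -
  have "set_integrable lborel (box p q) (\<lambda>z. f z * cnj (f z))"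
    using assms by (intro continuous_set_integrable_box continuous_intros)
  then have "integrable lborel (\<lambda>z. Re (indicator (box p q) z *\<^sub>R (f z * cnj (f z))))"
    unfolding set_integrable_def by (rule integrable_Re)
  then have "set_integrable lborel (box p q) (\<lambda>z. (cmod (f z))\<^sup>2)"
    by (simp only: complex_norm_square[symmetric] scaleR_complex.sel Re_complex_of_real set_integrable_def real_scaleR_def)
  moreover have "set_borel_measurable lborel (box p q) f"
    using continuous_set_integrable_box[OF assms, of p q]
    by (auto simp: set_integrable_def set_borel_measurable_def)
  ultimately show ?thesis by (simp add: L2_def)
qed

lemma box_L2_integrable: "f \<in> L2 (box p q) \<Longrightarrow> set_integrable lborel (box p q) f"
  by (rule L2_integrable[OF _ _ emeasure_box_finite]) auto

lemma L2_mult_smooth_integrable: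
  assumes "f \<in> L2 (box p q)" "smooth c"
  shows "set_integrable lborel (box p q) (\<lambda>z. f z * c z)"
proof -
  have c: "continuous_on UNIV c" using smooth_continuous_on[OF assms(2)] .
  obtain B where "\<And>z. z \<in> box p q \<Longrightarrow> cmod (c z) \<le> B"
    using continuous_bounded_on_box[OF c] by metis
  then show ?thesis
    using box_L2_integrable[OF assms(1)] c
    by (intro integrable_mult_bounded) (auto intro: borel_measurable_continuous_onI)
qed

text \<open>
  Uniqueness of weak derivatives and weak Laplacians up to null sets. It makes the representatives
  chosen by \<open>wpd\<close> and \<open>wlap\<close> accessible.
\<close>

lemma ae_eq_if_weakly_equal:
  assumes g: "g \<in> L2 (box p q)" and h: "h \<in> L2 (box p q)"
    and eq: "\<And>\<phi>. test_fun (box p q) \<phi> \<Longrightarrow>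
      (LINT z:box p q|lborel. g z * \<phi> z) = (LINT z:box p q|lborel. h z * \<phi> z)"
  shows "ae_eq (box p q) g h"
proof -
  have "AE z in lborel. z \<in> box p q \<longrightarrow> g z - h z = 0"
  proof (rule fundamental_lemma_of_variations)
    show "set_integrable lborel (box p q) (\<lambda>z. g z - h z)"
      using g h by (intro set_integral_diff box_L2_integrable)
    fix \<phi> assume \<phi>: "test_fun (box p q) \<phi>"
    then have "smooth \<phi>" by (simp add: test_fun_def)
    then have "(LINT z:box p q|lborel. g z * \<phi> z - h z * \<phi> z) = 0"
      using g h eq[OF \<phi>] by (simp add: set_integral_diff L2_mult_smooth_integrable)
    then show "(LINT z:box p q|lborel. (g z - h z) * \<phi> z) = 0"
      by (simp add: algebra_simps)
  qed
  then show ?thesis by (simp add: ae_eq_def)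
qed

lemma ae_eq_sym: "ae_eq S f g \<Longrightarrow> ae_eq S g f"
  by (auto simp: ae_eq_def elim: eventually_mono)

lemma wpd_ae_eq:
  assumes "has_weak_pd (box p q) b f g"
  shows "ae_eq (box p q) (wpd (box p q) b f) g"
proof -
  have "has_weak_pd (box p q) b f (wpd (box p q) b f)"
    unfolding wpd_def using assms by (rule someI[of "has_weak_pd (box p q) b f"])
  with assms show ?thesis
    by (intro ae_eq_if_weakly_equal) (auto simp: has_weak_pd_def)
qed

lemma wlap_ae_eq:
  assumes "has_weak_laplacian (box p q) f g"
  shows "ae_eq (box p q) (wlap (box p q) f) g"
proof -
  have "has_weak_laplacian (box p q) f (wlap (box p q) f)"
    unfolding wlap_def using assms by (rule someI[of "has_weak_laplacian (box p q) f"])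
  with assms show ?thesis
    by (intro ae_eq_if_weakly_equal) (auto simp: has_weak_laplacian_def)
qed

lemma has_weak_pd_wpd:
  "f \<in> H1 S \<Longrightarrow> b \<in> Basis \<Longrightarrow> has_weak_pd S b f (wpd S b f)"
proof -
  assume "f \<in> H1 S" "b \<in> Basis"
  then obtain g where "has_weak_pd S b f g" by (auto simp: H1_def)
  then show ?thesis unfolding wpd_def by (rule someI[of "has_weak_pd S b f"])
qed

lemma set_lebesgue_integral_ae_cong:
  fixes f g :: "'a::euclidean_space \<Rightarrow> 'b::{banach, second_countable_topology}"
  assumes "AE z in lborel. z \<in> S \<longrightarrow> f z = g z"
    "set_borel_measurable lborel S f" "set_borel_measurable lborel S g"
  shows "(LINT z:S|lborel. f z) = (LINT z:S|lborel. g z)"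
  unfolding set_lebesgue_integral_def
proof (rule integral_cong_AE)
  show "AE z in lborel. indicator S z *\<^sub>R f z = indicator S z *\<^sub>R g z"
    using assms(1) by eventually_elim (auto simp: indicator_def)
qed (use assms in \<open>simp_all add: set_borel_measurable_def\<close>)

lemma l2norm_ae_cong:
  assumes "ae_eq S f g" "f \<in> L2 S" "g \<in> L2 S"
  shows "l2norm S f = l2norm S g"
proof -
  have "(LINT z:S|lborel. (cmod (f z))\<^sup>2) = (LINT z:S|lborel. (cmod (g z))\<^sup>2)"
  proof (rule set_lebesgue_integral_ae_cong)
    show "AE z in lborel. z \<in> S \<longrightarrow> (cmod (f z))\<^sup>2 = (cmod (g z))\<^sup>2"
      using assms(1) unfolding ae_eq_def by eventually_elim simp
  next
    show "set_borel_measurable lborel S (\<lambda>z. (cmod (f z))\<^sup>2)" "set_borel_measurable lborel S (\<lambda>z. (cmod (g z))\<^sup>2)"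
      using assms(2,3) unfolding L2_def mem_Collect_eq set_integrable_def set_borel_measurable_def
      by (blast intro: borel_measurable_integrable)+
  qed
  then show ?thesis by (simp add: l2norm_def)
qed

lemma l2norm_nonneg: "l2norm S f \<ge> 0"
  unfolding l2norm_def set_lebesgue_integral_def by (auto intro!: integral_nonneg_AE)

lemma l2norm_zero [simp]: "l2norm S (\<lambda>_. 0) = 0"
  by (simp add: l2norm_def set_lebesgue_integral_def)

lemma l2norm_scale: "l2norm S (\<lambda>z. c * f z) = cmod c * l2norm S f"
  by (simp add: l2norm_def norm_mult power_mult_distrib real_sqrt_mult)

section \<open>Rectangles\<close>

lemma Basis_plane: "(Basis :: plane set) = {(1, 0), (0, 1)}"
  by (auto simp: Basis_prod_def)

lemma set_integral_box_eq_iterated: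
  fixes f :: "plane \<Rightarrow> complex"
  assumes "continuous_on UNIV f"
  shows "(LINT z:box (a, c) (b, d)|lborel. f z) = integral {a..b} (\<lambda>x. integral {c..d} (\<lambda>y. f (x, y)))"
    and "(LINT z:box (a, c) (b, d)|lborel. f z) = integral {c..d} (\<lambda>y. integral {a..b} (\<lambda>x. f (x, y)))"
proof -
  have f: "continuous_on S f" for S using assms continuous_on_subset by blast
  have "(LINT z:box (a, c) (b, d)|lborel. f z) = integral (cbox (a, c) (b, d)) f"
    using set_borel_integral_eq_integral(2)[OF continuous_set_integrable_box[OF assms]]
    by (simp add: integral_open_interval)
  also have "\<dots> = integral {a..b} (\<lambda>x. integral {c..d} (\<lambda>y. f (x, y)))"
    using integral_prod_continuous[OF f, of a c b d] by simp
  finally show 1: "(LINT z:box (a, c) (b, d)|lborel. f z) = integral {a..b} (\<lambda>x. integral {c..d} (\<lambda>y. f (x, y)))" .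
  show "(LINT z:box (a, c) (b, d)|lborel. f z) = integral {c..d} (\<lambda>y. integral {a..b} (\<lambda>x. f (x, y)))"
    using integral_swap_continuous[of a c b d "\<lambda>x y. f (x, y)"] f 1 by simp
qed

lemma pd_vector_derivative:
  fixes F :: "plane \<Rightarrow> complex"
  assumes "smooth F"
  shows "((\<lambda>x. F (x, y)) has_vector_derivative pd (1, 0) F (x, y)) (at x within S)"
    and "((\<lambda>y. F (x, y)) has_vector_derivative pd (0, 1) F (x, y)) (at y within S)"
proof -
  let ?D = "frechet_derivative F (at (x, y))"
  have D: "(F has_derivative ?D) (at (x, y))" using assms by (rule smooth_has_derivative)
  then interpret bounded_linear ?D by (rule has_derivative_bounded_linear)
  have "((\<lambda>x. (x, y)) has_derivative (\<lambda>h. (h, 0))) (at x within S)"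
    "((\<lambda>y. (x, y)) has_derivative (\<lambda>h. (0, h))) (at y within S)"
    by (auto intro!: derivative_eq_intros)
  from this[THEN has_derivative_compose, OF D] 
  have 1: "((\<lambda>x. F (x, y)) has_derivative (\<lambda>h. ?D (h, 0))) (at x within S)"
    "((\<lambda>y. F (x, y)) has_derivative (\<lambda>h. ?D (0, h))) (at y within S)" .
  have "?D (h, 0) = h *\<^sub>R pd (1, 0) F (x, y)" "?D (0, h) = h *\<^sub>R pd (0, 1) F (x, y)" for h
    using scale[of h "(1, 0)"] scale[of h "(0, 1)"] by (simp_all add: pd_def)
  with 1 show "((\<lambda>x. F (x, y)) has_vector_derivative pd (1, 0) F (x, y)) (at x within S)"
    "((\<lambda>y. F (x, y)) has_vector_derivative pd (0, 1) F (x, y)) (at y within S)"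
    by (simp_all add: has_vector_derivative_def)
qed

text \<open>
  The fundamental theorem of calculus in one variable and Fubini in the other. With \<open>F\<close> vanishing on the
  boundary it gives integration by parts; without, it produces the interface terms of Green's
  formula.
\<close>

lemma set_integral_pd_box:
  fixes F :: "plane \<Rightarrow> complex"
  assumes F: "smooth F" and "a \<le> b" "c \<le> d"
  shows "(LINT z:box (a, c) (b, d)|lborel. pd (1, 0) F z) = integral {c..d} (\<lambda>y. F (b, y) - F (a, y))"
    and "(LINT z:box (a, c) (b, d)|lborel. pd (0, 1) F z) = integral {a..b} (\<lambda>x. F (x, d) - F (x, c))"
proof -
  have s: "continuous_on UNIV (pd (1, 0) F)" "continuous_on UNIV (pd (0, 1) F)"
    by (auto intro!: smooth_continuous_on[OF smooth_pd[OF F]] simp: Basis_plane)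
  have "integral {a..b} (\<lambda>x. pd (1, 0) F (x, y)) = F (b, y) - F (a, y)" for y
    using fundamental_theorem_of_calculus[OF \<open>a \<le> b\<close> pd_vector_derivative(1)[OF F]]
    by (rule integral_unique)
  then show "(LINT z:box (a, c) (b, d)|lborel. pd (1, 0) F z) = integral {c..d} (\<lambda>y. F (b, y) - F (a, y))"
    using set_integral_box_eq_iterated(2)[OF s(1), of a c b d] by simp
  have "integral {c..d} (\<lambda>y. pd (0, 1) F (x, y)) = F (x, d) - F (x, c)" for x
    using fundamental_theorem_of_calculus[OF \<open>c \<le> d\<close> pd_vector_derivative(2)[OF F]]
    by (rule integral_unique)
  then show "(LINT z:box (a, c) (b, d)|lborel. pd (0, 1) F z) = integral {a..b} (\<lambda>x. F (x, d) - F (x, c))"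
    using set_integral_box_eq_iterated(1)[OF s(2), of a c b d] by simp
qed

lemma test_fun_set_integral_pd:
  fixes p q :: plane
  assumes "test_fun (box p q) F" "b \<in> Basis"
  shows "(LINT z:box p q|lborel. pd b F z) = 0"
proof (cases "box p q = {}")
  case True then show ?thesis by (simp add: set_lebesgue_integral_def)
next
  case False
  obtain x0 y0 x1 y1 where pq: "p = (x0, y0)" "q = (x1, y1)" by (cases p, cases q)
  have F: "smooth F" and zero: "\<And>z. z \<notin> box p q \<Longrightarrow> F z = 0"
    using assms(1) by (auto elim!: test_funE)
  have "x0 \<le> x1" "y0 \<le> y1" using False by (auto simp: box_ne_empty pq Basis_plane)
  note FTC = set_integral_pd_box[OF F this]
  have "F (x0, y) = 0" "F (x1, y) = 0" "F (x, y0) = 0" "F (x, y1) = 0" for x y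
    by (auto intro!: zero simp: pq mem_box Basis_plane)
  with FTC assms(2) show ?thesis by (auto simp: pq Basis_plane)
qed

lemma integration_by_parts_box:
  fixes p q :: plane
  assumes f: "smooth f" and \<phi>: "test_fun (box p q) \<phi>" and b: "b \<in> Basis"
  shows "(LINT z:box p q|lborel. f z * pd b \<phi> z) = - (LINT z:box p q|lborel. pd b f z * \<phi> z)"
proof -
  have s: "smooth \<phi>" using \<phi> by (simp add: test_fun_def)
  have i: "set_integrable lborel (box p q) (\<lambda>z. f z * pd b \<phi> z)" "set_integrable lborel (box p q) (\<lambda>z. pd b f z * \<phi> z)"
    by (intro continuous_set_integrable_box continuous_on_mult smooth_continuous_on smooth_pd f s b)+
  have "0 = (LINT z:box p q|lborel. pd b (\<lambda>z. f z * \<phi> z) z)"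
    using test_fun_set_integral_pd[OF test_fun_mult[OF f \<phi>] b] by simp
  also have "\<dots> = (LINT z:box p q|lborel. f z * pd b \<phi> z + pd b f z * \<phi> z)"
    using pd_mult[OF f s] by simp
  also have "\<dots> = (LINT z:box p q|lborel. f z * pd b \<phi> z) + (LINT z:box p q|lborel. pd b f z * \<phi> z)"
    using i by (rule set_integral_add)
  finally show ?thesis by (simp add: eq_neg_iff_add_eq_0)
qed

lemma smooth_has_weak_pd:
  fixes p q :: plane
  assumes "smooth f" "b \<in> Basis"
  shows "has_weak_pd (box p q) b f (pd b f)"
  unfolding has_weak_pd_def
  using integration_by_parts_box[OF assms(1) _ assms(2)] continuous_L2_box[OF smooth_continuous_on[OF smooth_pd[OF assms]]]
  by (intro conjI allI impI)

lemma smooth_laplacian: "smooth f \<Longrightarrow> smooth (laplacian (f :: plane \<Rightarrow> complex))"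
proof -
  assume f: "smooth f"
  have "laplacian f = (\<lambda>z. pd (1,0) (pd (1,0) f) z + pd (0,1) (pd (0,1) f) z)"
    by (auto simp: laplacian_def Basis_plane)
  moreover have "smooth (\<lambda>z. pd (1,0) (pd (1,0) f) z + pd (0,1) (pd (0,1) f) z)"
    by (intro smooth_add smooth_pd f; simp add: Basis_plane)
  ultimately show ?thesis by simp
qed

lemma smooth_has_weak_laplacian:
  fixes p q :: plane
  assumes f: "smooth f"
  shows "has_weak_laplacian (box p q) f (laplacian f)"
  unfolding has_weak_laplacian_def
proof (intro conjI allI impI)
  show "laplacian f \<in> L2 (box p q)"
    using f by (intro continuous_L2_box smooth_continuous_on smooth_laplacian)
  fix \<phi> assume \<phi>: "test_fun (box p q) \<phi>"
  then have s: "smooth \<phi>" by (simp add: test_fun_def)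
  have "(LINT z:box p q|lborel. f z * pd b (pd b \<phi>) z) = (LINT z:box p q|lborel. pd b (pd b f) z * \<phi> z)"
    if b: "b \<in> Basis" for b
    using integration_by_parts_box[OF f test_fun_pd[OF \<phi> b] b] integration_by_parts_box[OF smooth_pd[OF f b] \<phi> b] by simp
  moreover have "set_integrable lborel (box p q) (\<lambda>z. f z * pd b (pd b \<phi>) z)"
    "set_integrable lborel (box p q) (\<lambda>z. pd b (pd b f) z * \<phi> z)" if "b \<in> Basis" for b
    by (intro continuous_set_integrable_box continuous_on_mult smooth_continuous_on smooth_pd f s that)+
  ultimately show "(LINT z:box p q|lborel. f z * laplacian \<phi> z) = (LINT z:box p q|lborel. laplacian f z * \<phi> z)"
    by (simp add: laplacian_def Basis_plane distrib_left distrib_right set_integral_add)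
qed

lemma smooth_wpd: "smooth f \<Longrightarrow> b \<in> Basis \<Longrightarrow> ae_eq (box p q) (wpd (box p q) b f) (pd b f)"
  for p q :: plane
  by (intro wpd_ae_eq smooth_has_weak_pd)

lemma smooth_wlap: "smooth f \<Longrightarrow> ae_eq (box p q) (wlap (box p q) f) (laplacian f)"
  for p q :: plane
  by (intro wlap_ae_eq smooth_has_weak_laplacian)

lemma smooth_H1: "smooth f \<Longrightarrow> f \<in> H1 (box p q)" for p q :: plane
  unfolding H1_def mem_Collect_eq
  by (intro conjI ballI exI) (assumption | rule smooth_has_weak_pd continuous_L2_box smooth_continuous_on)+

lemma wpd_L2: "f \<in> H1 S \<Longrightarrow> b \<in> Basis \<Longrightarrow> wpd S b f \<in> L2 S"
  by (drule (1) has_weak_pd_wpd) (simp add: has_weak_pd_def)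

lemma wlap_L2: "has_weak_laplacian S f g \<Longrightarrow> wlap S f \<in> L2 S"
proof -
  assume "has_weak_laplacian S f g"
  then have "has_weak_laplacian S f (wlap S f)" unfolding wlap_def by (rule someI[of "has_weak_laplacian S f"])
  then show ?thesis by (simp add: has_weak_laplacian_def)
qed

lemma smooth_L2: "smooth f \<Longrightarrow> f \<in> L2 (box p q)"
  by (intro continuous_L2_box smooth_continuous_on)

lemma smooth_gradnorm:
  fixes p q :: plane
  assumes "smooth f"
  shows "gradnorm (box p q) f = sqrt (\<Sum>b\<in>Basis. (l2norm (box p q) (pd b f))\<^sup>2)"
proof -
  have "l2norm (box p q) (wpd (box p q) b f) = l2norm (box p q) (pd b f)" if "b \<in> Basis" for b
    using assms that by (intro l2norm_ae_cong smooth_wpd wpd_L2 smooth_H1 smooth_L2 smooth_pd)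
  then show ?thesis by (simp add: gradnorm_def)
qed

text \<open>
  A function smooth on the whole plane serves as its own approximating sequence in the definition
  of the trace.
\<close>

lemma has_trace_smooth:
  fixes p q r s :: plane
  assumes u: "smooth u" and g: "\<And>t. t \<in> {0<..<1} \<Longrightarrow> u (linepath r s t) = g t"
    and c: "continuous_on UNIV g"
  shows "has_trace (box p q) r s u g"
proof -
  have "pd b (\<lambda>_::plane. 0::complex) = (\<lambda>_. 0)" for b
    using pd_eqI[of "\<lambda>_::plane. 0::complex" "\<lambda>_. 0"] by (intro ext) simp
  then have "h1norm (box p q) (\<lambda>z. u z - u z) = 0"
    using smooth_gradnorm[OF smooth_const, of p q 0] by (simp add: h1norm_def)
  moreover have "l2norm {0<..<1} (\<lambda>t. u (linepath r s t) - g t) = 0"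
  proof -
    have "(LINT t:{0<..<1}|lborel. (cmod (u (linepath r s t) - g t))\<^sup>2) = (LINT t:{0<..<1::real}|lborel. 0)"
      by (intro set_lebesgue_integral_cong) (auto simp: g)
    then show ?thesis by (simp add: l2norm_def)
  qed
  moreover have "g \<in> L2 {0<..<1}"
    using continuous_L2_box[OF c, of 0 1] by (simp add: box_real)
  ultimately show ?thesis
    unfolding has_trace_def
    by (intro conjI exI[of _ "\<lambda>_. u"]) (simp_all add: u smooth_H1)
qed

section \<open>Convergence of pairings in Sobolev norm\<close>

text \<open>
  The Cauchy-Schwarz inequality against the constant 1, obtained from the nonnegativity of the
  integral of \<open>(m * cmod (f z) - I)\<^sup>2\<close> with \<open>m\<close> the measure of the box and \<open>I\<close> the integral of \<open>cmod f\<close>.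
\<close>

lemma set_integral_cmod_le_l2norm:
  fixes f :: "'a::euclidean_space \<Rightarrow> complex"
  assumes f: "f \<in> L2 (box p q)" and m: "measure lborel (box p q) > 0"
  shows "(LINT z:box p q|lborel. cmod (f z)) \<le> sqrt (measure lborel (box p q)) * l2norm (box p q) f"
proof -
  define m where "m = measure lborel (box p q)"
  define I where "I = (LINT z:box p q|lborel. cmod (f z))"
  define J where "J = (LINT z:box p q|lborel. (cmod (f z))\<^sup>2)"
  have c: "set_integrable lborel (box p q) (\<lambda>_. c :: real)" for c
    using emeasure_box_finite[of p q] by (auto simp: set_integrable_def)
  have i1: "set_integrable lborel (box p q) (\<lambda>z. cmod (f z))"
    using box_L2_integrable[OF f] by (rule set_integrable_norm)
  have i2: "set_integrable lborel (box p q) (\<lambda>z. (cmod (f z))\<^sup>2)"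
    using f by (simp add: L2_def)
  have one: "(LINT z:box p q|lborel. c) = m * c" for c :: real
    using emeasure_box_finite[of p q]
    by (simp add: set_lebesgue_integral_def m_def)
  have "0 \<le> (LINT z:box p q|lborel. (m * cmod (f z) - I)\<^sup>2)"
    unfolding set_lebesgue_integral_def by (intro Bochner_Integration.integral_nonneg) simp
  also have "\<dots> = (LINT z:box p q|lborel. (m\<^sup>2 * (cmod (f z))\<^sup>2 - (2 * m * I) * cmod (f z)) + I\<^sup>2)"
    by (simp add: power2_diff power_mult_distrib algebra_simps)
  also have "\<dots> = (LINT z:box p q|lborel. m\<^sup>2 * (cmod (f z))\<^sup>2 - (2 * m * I) * cmod (f z)) + (LINT z:box p q|lborel. I\<^sup>2)"
    by (intro set_integral_add(2) set_integral_diff(1) set_integrable_mult_right i1 i2 c)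
  also have "\<dots> = (LINT z:box p q|lborel. m\<^sup>2 * (cmod (f z))\<^sup>2) - (LINT z:box p q|lborel. (2 * m * I) * cmod (f z)) + (LINT z:box p q|lborel. I\<^sup>2)"
    by (subst set_integral_diff(2)) (intro set_integrable_mult_right i1 i2 refl)+
  also have "\<dots> = m\<^sup>2 * J - 2 * m * I * I + m * I\<^sup>2"
    by (simp add: one I_def[symmetric] J_def[symmetric])
  also have "\<dots> = m * (m * J - I\<^sup>2)"
    by (simp add: algebra_simps power2_eq_square)
  finally have "I\<^sup>2 \<le> m * J"
    using m by (simp add: m_def[symmetric] zero_le_mult_iff)
  then have "I \<le> sqrt (m * J)" by (rule real_le_rsqrt)
  then show ?thesis by (simp add: real_sqrt_mult l2norm_def I_def J_def m_def)
qed

lemma L2_pairing_bound: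
  fixes f c :: "'a::euclidean_space \<Rightarrow> complex"
  assumes f: "f \<in> L2 (box p q)" and m: "measure lborel (box p q) > 0"
    and sub: "box r s \<subseteq> box p q"
    and c: "c \<in> borel_measurable borel" and bd: "\<And>z. z \<in> box r s \<Longrightarrow> cmod (c z) \<le> B" and "B \<ge> 0"
  shows "cmod (LINT z:box r s|lborel. f z * c z) \<le> B * (sqrt (measure lborel (box p q)) * l2norm (box p q) f)"
proof -
  have i: "set_integrable lborel (box p q) f" using f by (rule box_L2_integrable)
  have i': "set_integrable lborel (box r s) f" by (rule set_integrable_subset[OF i _ sub]) simp
  have n: "set_integrable lborel (box p q) (\<lambda>z. cmod (f z))" using i by (rule set_integrable_norm)
  have "cmod (LINT z:box r s|lborel. f z * c z) \<le> (LINT z:box r s|lborel. cmod (f z * c z))"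
    using integrable_mult_bounded[OF i' c bd] by (rule set_integral_norm_bound)
  also have "\<dots> \<le> (LINT z:box p q|lborel. B * cmod (f z))"
    unfolding set_lebesgue_integral_def
  proof (rule integral_mono)
    show "integrable lborel (\<lambda>z. indicator (box r s) z *\<^sub>R cmod (f z * c z))"
      using integrable_mult_bounded[OF i' c bd, THEN set_integrable_norm] by (simp add: set_integrable_def)
    show "integrable lborel (\<lambda>z. indicator (box p q) z *\<^sub>R (B * cmod (f z)))"
      using set_integrable_mult_right[OF n, of B] by (simp add: set_integrable_def)
    fix z
    show "indicator (box r s) z *\<^sub>R cmod (f z * c z) \<le> indicator (box p q) z *\<^sub>R (B * cmod (f z))"
    proof (cases "z \<in> box r s")
      case True
      then show ?thesis using sub bd[OF True]
        by (auto simp: indicator_def norm_mult mult.commute[of "cmod (f z)"] intro!: mult_right_mono)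
    next
      case False then show ?thesis using \<open>B \<ge> 0\<close> by (simp add: indicator_def)
    qed
  qed
  also have "\<dots> = B * (LINT z:box p q|lborel. cmod (f z))" by simp
  also have "\<dots> \<le> B * (sqrt (measure lborel (box p q)) * l2norm (box p q) f)"
    using set_integral_cmod_le_l2norm[OF f m] \<open>B \<ge> 0\<close> by (rule mult_left_mono)
  finally show ?thesis .
qed

lemma L2_diff:
  assumes "f \<in> L2 S" "g \<in> L2 S" shows "(\<lambda>z. f z - g z) \<in> L2 S"
proof -
  have m: "set_borel_measurable lborel S (\<lambda>z. f z - g z)"
  proof -
    have "(\<lambda>z. indicator S z *\<^sub>R f z - indicator S z *\<^sub>R g z) \<in> borel_measurable lborel"
      using assms by (intro borel_measurable_diff) (simp_all add: L2_def set_borel_measurable_def)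
    then show ?thesis by (simp add: set_borel_measurable_def scaleR_diff_right)
  qed
  have "set_integrable lborel S (\<lambda>z. 2 * (cmod (f z))\<^sup>2 + 2 * (cmod (g z))\<^sup>2)"
    using assms by (intro set_integral_add set_integrable_mult_right) (simp_all add: L2_def)
  then have "set_integrable lborel S (\<lambda>z. (cmod (f z - g z))\<^sup>2)"
  proof (rule set_integrable_bound)
    have "(\<lambda>z. (cmod (indicator S z *\<^sub>R (f z - g z)))\<^sup>2) \<in> borel_measurable lborel"
      using m unfolding set_borel_measurable_def by measurable
    moreover have "(\<lambda>z. (cmod (indicator S z *\<^sub>R (f z - g z)))\<^sup>2) = (\<lambda>z. indicator S z *\<^sub>R (cmod (f z - g z))\<^sup>2)"
      by (auto simp: indicator_def)
    ultimately show "set_borel_measurable lborel S (\<lambda>z. (cmod (f z - g z))\<^sup>2)"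
      by (simp add: set_borel_measurable_def)
    have "(cmod (f z - g z))\<^sup>2 \<le> 2 * (cmod (f z))\<^sup>2 + 2 * (cmod (g z))\<^sup>2" for z
    proof -
      have "(cmod (f z - g z))\<^sup>2 \<le> (cmod (f z) + cmod (g z))\<^sup>2"
        by (intro power_mono norm_triangle_ineq4) simp
      also have "\<dots> \<le> 2 * (cmod (f z))\<^sup>2 + 2 * (cmod (g z))\<^sup>2"
        using zero_le_power2[of "cmod (f z) - cmod (g z)"] by (simp add: power2_sum power2_diff)
      finally show ?thesis .
    qed
    then show "AE z in lborel. z \<in> S \<longrightarrow> norm ((cmod (f z - g z))\<^sup>2) \<le> norm (2 * (cmod (f z))\<^sup>2 + 2 * (cmod (g z))\<^sup>2)"
      by simp
  qed
  with m show ?thesis by (simp add: L2_def)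
qed

lemma has_weak_pd_diff:
  assumes "f \<in> L2 (box p q)" "f' \<in> L2 (box p q)" "b \<in> Basis"
    and "has_weak_pd (box p q) b f g" "has_weak_pd (box p q) b f' g'"
  shows "has_weak_pd (box p q) b (\<lambda>z. f z - f' z) (\<lambda>z. g z - g' z)"
  unfolding has_weak_pd_def
proof (intro conjI allI impI)
  have g: "g \<in> L2 (box p q)" "g' \<in> L2 (box p q)" using assms by (simp_all add: has_weak_pd_def)
  then show "(\<lambda>z. g z - g' z) \<in> L2 (box p q)" by (rule L2_diff)
  fix \<phi> assume \<phi>: "test_fun (box p q) \<phi>"
  then have s: "smooth \<phi>" "smooth (pd b \<phi>)" using assms(3) by (simp_all add: test_fun_def smooth_pd)
  have "(LINT z:box p q|lborel. (f z - f' z) * pd b \<phi> z)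
      = (LINT z:box p q|lborel. f z * pd b \<phi> z) - (LINT z:box p q|lborel. f' z * pd b \<phi> z)"
    using L2_mult_smooth_integrable[OF assms(1) s(2)] L2_mult_smooth_integrable[OF assms(2) s(2)]
    by (simp add: left_diff_distrib set_integral_diff)
  also have "\<dots> = - (LINT z:box p q|lborel. g z * \<phi> z) - - (LINT z:box p q|lborel. g' z * \<phi> z)"
    using assms(4,5) \<phi> by (simp add: has_weak_pd_def)
  also have "\<dots> = - (LINT z:box p q|lborel. (g z - g' z) * \<phi> z)"
    using L2_mult_smooth_integrable[OF g(1) s(1)] L2_mult_smooth_integrable[OF g(2) s(1)]
    by (simp add: left_diff_distrib set_integral_diff)
  finally show "(LINT z:box p q|lborel. (f z - f' z) * pd b \<phi> z) = - (LINT z:box p q|lborel. (g z - g' z) * \<phi> z)" .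
qed

lemma H1_diff:
  assumes "f \<in> H1 (box p q)" "g \<in> H1 (box p q)"
  shows "(\<lambda>z. f z - g z) \<in> H1 (box p q)"
  unfolding H1_def mem_Collect_eq
proof (intro conjI ballI)
  have l: "f \<in> L2 (box p q)" "g \<in> L2 (box p q)" using assms by (simp_all add: H1_def)
  then show "(\<lambda>z. f z - g z) \<in> L2 (box p q)" by (rule L2_diff)
  fix b :: 'a assume b: "b \<in> Basis"
  show "\<exists>h. has_weak_pd (box p q) b (\<lambda>z. f z - g z) h"
    using has_weak_pd_diff[OF l b has_weak_pd_wpd[OF assms(1) b] has_weak_pd_wpd[OF assms(2) b]] by (intro exI)
qed

lemma l2norm_le_h1norm:
  shows "l2norm S f \<le> h1norm S f" and "b \<in> Basis \<Longrightarrow> l2norm S (wpd S b f) \<le> h1norm S f"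
proof -
  have g: "gradnorm S f ^ 2 = (\<Sum>b\<in>Basis. (l2norm S (wpd S b f))\<^sup>2)"
    by (simp add: gradnorm_def sum_nonneg)
  show "l2norm S f \<le> h1norm S f"
    unfolding h1norm_def by (intro real_le_rsqrt) simp
  assume "b \<in> Basis"
  then have "(l2norm S (wpd S b f))\<^sup>2 \<le> gradnorm S f ^ 2"
    unfolding g by (intro member_le_sum) auto
  then have "(l2norm S (wpd S b f))\<^sup>2 \<le> (l2norm S f)\<^sup>2 + (gradnorm S f)\<^sup>2"
    by (meson add_increasing zero_le_power2)
  then show "l2norm S (wpd S b f) \<le> h1norm S f"
    unfolding h1norm_def by (rule real_le_rsqrt)
qed

text \<open>
  Pairing with a smooth function is continuous in \<open>L2\<close>, since a smooth function is bounded on a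
  box. The limit is taken in the norm of the larger box because test functions live on the union of
  both squares while each Green integral extends over one of them.
\<close>

lemma L2_pairing_tendsto:
  fixes c :: "'a::euclidean_space \<Rightarrow> complex"
  assumes f: "\<And>n. f n \<in> L2 (box p q)" "g \<in> L2 (box p q)" and m: "measure lborel (box p q) > 0"
    and sub: "box r s \<subseteq> box p q" and c: "smooth c"
    and lim: "(\<lambda>n. l2norm (box p q) (\<lambda>z. f n z - g z)) \<longlonglongrightarrow> 0"
  shows "(\<lambda>n. LINT z:box r s|lborel. f n z * c z) \<longlonglongrightarrow> (LINT z:box r s|lborel. g z * c z)"
proof -
  have cc: "continuous_on UNIV c" using c by (rule smooth_continuous_on)
  obtain B where B: "B \<ge> 0" "\<And>z. z \<in> box r s \<Longrightarrow> cmod (c z) \<le> B"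
    using continuous_bounded_on_box[OF cc] by metis
  have L2r: "h \<in> L2 (box p q) \<Longrightarrow> set_integrable lborel (box r s) (\<lambda>z. h z * c z)" for h
    using set_integrable_subset[OF L2_mult_smooth_integrable[OF _ c] _ sub] by simp
  let ?K = "B * sqrt (measure lborel (box p q))"
  have "cmod ((LINT z:box r s|lborel. f n z * c z) - (LINT z:box r s|lborel. g z * c z))
      \<le> ?K * l2norm (box p q) (\<lambda>z. f n z - g z)" for n
  proof -
    have "(LINT z:box r s|lborel. f n z * c z) - (LINT z:box r s|lborel. g z * c z)
        = (LINT z:box r s|lborel. (f n z - g z) * c z)"
      using L2r[OF f(1)] L2r[OF f(2)] by (simp add: left_diff_distrib set_integral_diff)
    with L2_pairing_bound[OF L2_diff[OF f] m sub borel_measurable_continuous_onI[OF cc] B(2,1), of n]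
    show ?thesis by (simp add: mult.assoc)
  qed
  then have "\<forall>\<^sub>F n in sequentially. norm ((LINT z:box r s|lborel. f n z * c z) - (LINT z:box r s|lborel. g z * c z))
      \<le> ?K * l2norm (box p q) (\<lambda>z. f n z - g z)"
    by (intro always_eventually allI)
  then have "(\<lambda>n. (LINT z:box r s|lborel. f n z * c z) - (LINT z:box r s|lborel. g z * c z)) \<longlonglongrightarrow> 0"
    by (rule Lim_null_comparison) (rule tendsto_mult_right_zero[OF lim])
  then show ?thesis by (rule LIM_zero_cancel)
qed

section \<open>Green's formula\<close>

lemma \<Omega>_box: "\<Omega>m = box (-1, 0) (0, 1)" "\<Omega>p = box (0, 0) (1, 1)" "\<Omega>full = box (-1, 0) (1, 1)"
  by (auto simp: \<Omega>m_def \<Omega>p_def \<Omega>full_def mem_box Basis_plane)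

lemma measure_\<Omega>full: "measure lborel \<Omega>full > 0"
  by (simp add: \<Omega>_box measure_lborel_box_eq Basis_plane)

text \<open>
  For smooth \<open>u\<close> all weak derivatives of \<open>u\<close> may be replaced by classical ones; the function \<open>\<phi>\<close> is only
  weakly differentiable. Each summand on the right is a pairing to which \<open>L2_pairing_tendsto\<close>
  applies.
\<close>

lemma green_integral_smooth:
  assumes u: "smooth u" and \<phi>: "\<phi> \<in> H1 \<Omega>full" and sub: "box r s \<subseteq> \<Omega>full"
  shows "green_integral (box r s) u \<phi> =
    (\<Sum>b\<in>Basis. LINT z:box r s|lborel. wpd \<Omega>full b \<phi> z * pd b u z) + (LINT z:box r s|lborel. \<phi> z * laplacian u z)"
proof -
  have b: "(1, 0) \<in> (Basis :: plane set)" "(0, 1) \<in> (Basis :: plane set)" by (simp_all add: Basis_plane)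
  have pdu: "smooth (pd b u)" if "b \<in> Basis" for b using u that by (rule smooth_pd)
  have int: "set_integrable lborel (box r s) (\<lambda>z. f z * c z)" if "f \<in> L2 \<Omega>full" "smooth c" for f c
    using set_integrable_subset[OF L2_mult_smooth_integrable[OF that[unfolded \<Omega>_box]] _ sub[unfolded \<Omega>_box]] by simp
  note i = int[OF wpd_L2[OF \<phi> b(1)] pdu[OF b(1)]] int[OF wpd_L2[OF \<phi> b(2)] pdu[OF b(2)]]
    int[of \<phi>, OF _ smooth_laplacian[OF u]]
  have \<phi>2: "\<phi> \<in> L2 \<Omega>full" using \<phi> by (simp add: H1_def)
  let ?g = "\<lambda>z. (wpd \<Omega>full (1,0) \<phi> z * pd (1,0) u z + wpd \<Omega>full (0,1) \<phi> z * pd (0,1) u z) + \<phi> z * laplacian u z"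
  have ig: "set_integrable lborel (box r s) ?g"
    by (intro set_integral_add(1) i \<phi>2)
  have meas: "set_borel_measurable lborel (box r s) f" if "f \<in> L2 (box r s)" for f
    using that by (simp add: L2_def)
  have measf: "set_borel_measurable lborel (box r s) f" if "f \<in> L2 \<Omega>full" for f
    using set_integrable_subset[OF box_L2_integrable[OF that[unfolded \<Omega>_box]] _ sub[unfolded \<Omega>_box]]
    by (auto simp: set_integrable_def set_borel_measurable_def)
  have prod: "set_borel_measurable lborel (box r s) (\<lambda>z. f z * g z)"
    if "set_borel_measurable lborel (box r s) f" "set_borel_measurable lborel (box r s) g" for f g :: "plane \<Rightarrow> complex"
  proof -
    have "(\<lambda>z. (indicator (box r s) z *\<^sub>R f z) * (indicator (box r s) z *\<^sub>R g z)) \<in> borel_measurable lborel"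
      using that unfolding set_borel_measurable_def by (rule borel_measurable_times)
    moreover have "(\<lambda>z. (indicator (box r s) z *\<^sub>R f z) * (indicator (box r s) z *\<^sub>R g z)) = (\<lambda>z. indicator (box r s) z *\<^sub>R (f z * g z))"
      by (auto simp: indicator_def)
    ultimately show ?thesis by (simp add: set_borel_measurable_def)
  qed
  have add: "set_borel_measurable lborel (box r s) (\<lambda>z. f z + g z)"
    if "set_borel_measurable lborel (box r s) f" "set_borel_measurable lborel (box r s) g" for f g :: "plane \<Rightarrow> complex"
  proof -
    have "(\<lambda>z. (indicator (box r s) z *\<^sub>R f z) + (indicator (box r s) z *\<^sub>R g z)) \<in> borel_measurable lborel"
      using that unfolding set_borel_measurable_def by (rule borel_measurable_add)
    then show ?thesis by (simp add: set_borel_measurable_def scaleR_add_right)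
  qed
  have "green_integral (box r s) u \<phi> = (LINT z:box r s|lborel. ?g z)"
    unfolding green_integral_def
  proof (rule set_lebesgue_integral_ae_cong)
    have "AE z in lborel. z \<in> box r s \<longrightarrow> wpd (box r s) (1,0) u z = pd (1,0) u z"
      "AE z in lborel. z \<in> box r s \<longrightarrow> wpd (box r s) (0,1) u z = pd (0,1) u z"
      "AE z in lborel. z \<in> box r s \<longrightarrow> wlap (box r s) u z = laplacian u z"
      using smooth_wpd[OF u b(1)] smooth_wpd[OF u b(2)] smooth_wlap[OF u] by (simp_all add: ae_eq_def)
    then show "AE z in lborel. z \<in> box r s \<longrightarrow>
      (\<Sum>b\<in>Basis. wpd (box r s) b u z * wpd \<Omega>full b \<phi> z) + \<phi> z * wlap (box r s) u z = ?g z"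
      by eventually_elim (simp add: Basis_plane mult.commute)
    show "set_borel_measurable lborel (box r s) ?g"
      using ig by (auto simp: set_integrable_def set_borel_measurable_def)
    have "set_borel_measurable lborel (box r s) (\<lambda>z. (wpd (box r s) (1,0) u z * wpd \<Omega>full (1,0) \<phi> z +
        wpd (box r s) (0,1) u z * wpd \<Omega>full (0,1) \<phi> z) + \<phi> z * wlap (box r s) u z)"
      by (intro add prod meas[OF wpd_L2[OF smooth_H1[OF u]]] b measf[OF wpd_L2[OF \<phi>]] measf[OF \<phi>2]
          meas[OF wlap_L2[OF smooth_has_weak_laplacian[OF u]]])
    then show "set_borel_measurable lborel (box r s) (\<lambda>z. (\<Sum>b\<in>Basis. wpd (box r s) b u z * wpd \<Omega>full b \<phi> z) + \<phi> z * wlap (box r s) u z)"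
      by (simp add: Basis_plane)
  qed
  also have "\<dots> = (LINT z:box r s|lborel. wpd \<Omega>full (1,0) \<phi> z * pd (1,0) u z)
     + (LINT z:box r s|lborel. wpd \<Omega>full (0,1) \<phi> z * pd (0,1) u z) + (LINT z:box r s|lborel. \<phi> z * laplacian u z)"
    using i \<phi>2 by (simp add: set_integral_add)
  finally show ?thesis by (simp add: Basis_plane)
qed

text \<open>
  The density step: the Green integral is continuous in \<open>\<phi>\<close> with respect to the \<open>H1\<close> norm. Linearity of
  the weak derivative relates the difference of the chosen derivatives of \<open>\<psi> n\<close> and \<open>\<phi>\<close> to the
  derivative of \<open>\<psi> n - \<phi>\<close> that enters \<open>h1norm\<close>.
\<close>

lemma green_integral_tendsto:
  assumes u: "smooth u" and \<phi>: "\<phi> \<in> H1 \<Omega>full" and sub: "box r s \<subseteq> \<Omega>full"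
    and \<psi>: "\<And>n. smooth (\<psi> n)" and lim: "(\<lambda>n. h1norm \<Omega>full (\<lambda>z. \<psi> n z - \<phi> z)) \<longlonglongrightarrow> 0"
  shows "(\<lambda>n. green_integral (box r s) u (\<psi> n)) \<longlonglongrightarrow> green_integral (box r s) u \<phi>"
proof -
  have \<psi>1: "\<psi> n \<in> H1 \<Omega>full" for n using \<psi> by (simp add: \<Omega>_box smooth_H1)
  note m = measure_\<Omega>full[unfolded \<Omega>_box]
  have L2: "f \<in> L2 \<Omega>full" if "f \<in> H1 \<Omega>full" for f using that by (simp add: H1_def)
  have squeeze: "(\<lambda>n. l2norm \<Omega>full (h n)) \<longlonglongrightarrow> 0"
    if "\<And>n. l2norm \<Omega>full (h n) \<le> h1norm \<Omega>full (\<lambda>z. \<psi> n z - \<phi> z)" for h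
    by (rule tendsto_sandwich[OF always_eventually always_eventually tendsto_const lim])
      (intro allI l2norm_nonneg that)+
  have "(\<lambda>n. LINT z:box r s|lborel. wpd \<Omega>full b (\<psi> n) z * pd b u z) \<longlonglongrightarrow> (LINT z:box r s|lborel. wpd \<Omega>full b \<phi> z * pd b u z)"
    if b: "b \<in> Basis" for b
  proof (rule L2_pairing_tendsto[OF _ _ m sub[unfolded \<Omega>_box] smooth_pd[OF u b]], fold \<Omega>_box)
    show "wpd \<Omega>full b (\<psi> n) \<in> L2 \<Omega>full" "wpd \<Omega>full b \<phi> \<in> L2 \<Omega>full" for n
      using \<psi>1 \<phi> b by (auto intro: wpd_L2)
    have eq: "l2norm \<Omega>full (\<lambda>z. wpd \<Omega>full b (\<psi> n) z - wpd \<Omega>full b \<phi> z) = l2norm \<Omega>full (wpd \<Omega>full b (\<lambda>z. \<psi> n z - \<phi> z))" for n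
    proof (rule l2norm_ae_cong[OF ae_eq_sym])
      have "has_weak_pd \<Omega>full b (\<lambda>z. \<psi> n z - \<phi> z) (\<lambda>z. wpd \<Omega>full b (\<psi> n) z - wpd \<Omega>full b \<phi> z)"
        using has_weak_pd_diff[folded \<Omega>_box, OF _ _ b] L2 \<psi>1 \<phi> has_weak_pd_wpd[OF _ b] by (simp add: \<Omega>_box)
      then show "ae_eq \<Omega>full (wpd \<Omega>full b (\<lambda>z. \<psi> n z - \<phi> z)) (\<lambda>z. wpd \<Omega>full b (\<psi> n) z - wpd \<Omega>full b \<phi> z)"
        unfolding \<Omega>_box by (rule wpd_ae_eq)
      show "(\<lambda>z. wpd \<Omega>full b (\<psi> n) z - wpd \<Omega>full b \<phi> z) \<in> L2 \<Omega>full"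
        by (intro L2_diff wpd_L2 \<psi>1 \<phi> b)
      show "wpd \<Omega>full b (\<lambda>z. \<psi> n z - \<phi> z) \<in> L2 \<Omega>full"
        using \<psi>1 \<phi> by (intro wpd_L2 b) (simp add: \<Omega>_box H1_diff)
    qed
    show "(\<lambda>n. l2norm \<Omega>full (\<lambda>z. wpd \<Omega>full b (\<psi> n) z - wpd \<Omega>full b \<phi> z)) \<longlonglongrightarrow> 0"
      by (rule squeeze) (simp add: eq l2norm_le_h1norm(2)[OF b])
  qed
  moreover have "(\<lambda>n. LINT z:box r s|lborel. \<psi> n z * laplacian u z) \<longlonglongrightarrow> (LINT z:box r s|lborel. \<phi> z * laplacian u z)"
  proof (rule L2_pairing_tendsto[OF _ _ m sub[unfolded \<Omega>_box] smooth_laplacian[OF u]], fold \<Omega>_box)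
    show "(\<lambda>n. l2norm \<Omega>full (\<lambda>z. \<psi> n z - \<phi> z)) \<longlonglongrightarrow> 0"
      by (rule squeeze) (rule l2norm_le_h1norm(1))
  qed (use L2 \<psi>1 \<phi> in auto)
  ultimately show ?thesis
    unfolding green_integral_smooth[OF u \<phi> sub] green_integral_smooth[OF u \<psi>1 sub]
    by (intro tendsto_add tendsto_sum)
qed

text \<open>
  The integrand is the divergence of \<open>\<psi>\<close> times the gradient of \<open>u\<close>. The horizontal edges lie on the
  boundary of \<open>\<Omega>full\<close>, where \<open>\<psi>\<close> vanishes, so only the vertical edges contribute.
\<close>

lemma green_integral_test_fun:
  assumes u: "smooth u" and \<psi>: "test_fun \<Omega>full \<psi>" and ab: "-1 \<le> a" "a \<le> b" "b \<le> 1"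
  shows "green_integral (box (a, 0) (b, 1)) u \<psi>
    = integral {0..1} (\<lambda>y. \<psi> (b, y) * pd (1, 0) u (b, y) - \<psi> (a, y) * pd (1, 0) u (a, y))"
proof -
  let ?R = "box (a, 0) (b, 1)"
  have B: "(1, 0) \<in> (Basis :: plane set)" "(0, 1) \<in> (Basis :: plane set)" by (simp_all add: Basis_plane)
  have s: "smooth \<psi>" and zero: "\<And>z. z \<notin> \<Omega>full \<Longrightarrow> \<psi> z = 0"
    using \<psi> by (auto elim!: test_funE)
  have sub: "?R \<subseteq> \<Omega>full" using ab by (auto simp: \<Omega>_box mem_box Basis_plane)
  have F: "smooth (\<lambda>z. \<psi> z * pd b u z)" if "b \<in> Basis" for b
    using s u that by (intro smooth_mult smooth_pd)
  have pdF: "pd b (\<lambda>z. \<psi> z * pd b u z) z = \<psi> z * pd b (pd b u) z + pd b \<psi> z * pd b u z" if "b \<in> Basis" for b z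
    using pd_mult[OF s smooth_pd[OF u that]] .
  have cong: "(LINT z:?R|lborel. wpd \<Omega>full b \<psi> z * pd b u z) = (LINT z:?R|lborel. pd b \<psi> z * pd b u z)"
    if b: "b \<in> Basis" for b
  proof (rule set_lebesgue_integral_ae_cong)
    have "AE z in lborel. z \<in> \<Omega>full \<longrightarrow> wpd \<Omega>full b \<psi> z = pd b \<psi> z"
      using smooth_wpd[OF s b] by (simp add: ae_eq_def \<Omega>_box)
    then show "AE z in lborel. z \<in> ?R \<longrightarrow> wpd \<Omega>full b \<psi> z * pd b u z = pd b \<psi> z * pd b u z"
      by eventually_elim (use sub in auto)
    have "set_integrable lborel ?R (\<lambda>z. wpd \<Omega>full b \<psi> z * pd b u z)"
      using set_integrable_subset[OF L2_mult_smooth_integrable[OF wpd_L2[OF smooth_H1[OF s] b] smooth_pd[OF u b]] _ sub[unfolded \<Omega>_box]]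
      by (simp add: \<Omega>_box)
    then show "set_borel_measurable lborel ?R (\<lambda>z. wpd \<Omega>full b \<psi> z * pd b u z)"
      by (auto simp: set_integrable_def set_borel_measurable_def)
    have "set_integrable lborel ?R (\<lambda>z. pd b \<psi> z * pd b u z)"
      by (intro L2_mult_smooth_integrable smooth_L2 smooth_pd s u b)
    then show "set_borel_measurable lborel ?R (\<lambda>z. pd b \<psi> z * pd b u z)"
      by (auto simp: set_integrable_def set_borel_measurable_def)
  qed
  have i: "set_integrable lborel ?R f" if "smooth f" for f :: "plane \<Rightarrow> complex"
    using that by (intro box_L2_integrable smooth_L2)
  have i1: "set_integrable lborel ?R (\<lambda>z. pd b \<psi> z * pd b u z)"
      "set_integrable lborel ?R (\<lambda>z. \<psi> z * pd b (pd b u) z)" if "b \<in> Basis" for b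
    using that by (auto intro!: i smooth_mult smooth_pd s u)
  have split: "(LINT z:?R|lborel. pd b (\<lambda>z. \<psi> z * pd b u z) z) =
     (LINT z:?R|lborel. \<psi> z * pd b (pd b u) z) + (LINT z:?R|lborel. pd b \<psi> z * pd b u z)" if "b \<in> Basis" for b
    unfolding pdF[OF that] using i1[OF that] by (intro set_integral_add(2))
  have "green_integral ?R u \<psi> = (\<Sum>b\<in>Basis. LINT z:?R|lborel. wpd \<Omega>full b \<psi> z * pd b u z) + (LINT z:?R|lborel. \<psi> z * laplacian u z)"
    by (rule green_integral_smooth[OF u _ sub]) (simp add: \<Omega>_box smooth_H1 s)
  also have "(LINT z:?R|lborel. \<psi> z * laplacian u z) = (\<Sum>b\<in>Basis. LINT z:?R|lborel. \<psi> z * pd b (pd b u) z)"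
    using i1(2)[OF B(1)] i1(2)[OF B(2)] by (simp add: laplacian_def Basis_plane distrib_left set_integral_add)
  also have "(\<Sum>b\<in>Basis. LINT z:?R|lborel. wpd \<Omega>full b \<psi> z * pd b u z) + \<dots>
      = (\<Sum>b\<in>Basis. LINT z:?R|lborel. pd b (\<lambda>z. \<psi> z * pd b u z) z)"
    using cong split by (simp add: sum.distrib[symmetric] add.commute)
  also have "\<dots> = integral {0..1} (\<lambda>y. \<psi> (b, y) * pd (1, 0) u (b, y) - \<psi> (a, y) * pd (1, 0) u (a, y))
     + integral {a..b} (\<lambda>x. \<psi> (x, 1) * pd (0, 1) u (x, 1) - \<psi> (x, 0) * pd (0, 1) u (x, 0))"
    using set_integral_pd_box(1)[OF F[OF B(1)] ab(2), of 0 1] set_integral_pd_box(2)[OF F[OF B(2)] ab(2), of 0 1]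
    by (simp add: Basis_plane)
  also have "integral {a..b} (\<lambda>x. \<psi> (x, 1) * pd (0, 1) u (x, 1) - \<psi> (x, 0) * pd (0, 1) u (x, 0)) = 0"
  proof -
    have "\<psi> (x, 1) = 0" "\<psi> (x, 0) = 0" for x by (auto intro!: zero simp: \<Omega>full_def)
    then show ?thesis by simp
  qed
  finally show ?thesis by simp
qed

text \<open>
  The two squares see the interface from opposite sides, so equal normal derivatives make the
  interface terms cancel.
\<close>

lemma same_normal_trace_smooth:
  assumes u: "smooth u" and w: "smooth w"
    and eq: "\<And>y. y \<in> {0..1} \<Longrightarrow> pd (1, 0) u (0, y) = pd (1, 0) w (0, y)"
  shows "same_normal_trace_\<Gamma> u w"
  unfolding same_normal_trace_\<Gamma>_def
proof
  fix \<phi> assume "\<phi> \<in> H10 \<Omega>full"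
  then obtain \<psi> where \<phi>: "\<phi> \<in> H1 \<Omega>full" and \<psi>: "\<And>n. test_fun \<Omega>full (\<psi> n)"
    and lim: "(\<lambda>n::nat. h1norm \<Omega>full (\<lambda>z. \<psi> n z - \<phi> z)) \<longlonglongrightarrow> 0"
    by (auto simp: H10_def)
  have s: "smooth (\<psi> n)" for n using \<psi> by (simp add: test_fun_def)
  have zero: "\<psi> n z = 0" if "z \<notin> \<Omega>full" for n z using \<psi>[of n] that by (auto elim!: test_funE)
  have "\<Omega>m \<subseteq> \<Omega>full" "\<Omega>p \<subseteq> \<Omega>full" by (auto simp: \<Omega>m_def \<Omega>p_def \<Omega>full_def)
  note sub = this[unfolded \<Omega>_box(1,2)]
  have "green_integral \<Omega>m u (\<psi> n) + green_integral \<Omega>p w (\<psi> n) = 0" for n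
  proof -
    have z: "\<psi> n (-1, y) = 0" "\<psi> n (1, y) = 0" for y by (auto intro!: zero simp: \<Omega>full_def)
    have "integral {0..1} (\<lambda>y. \<psi> n (0, y) * pd (1, 0) u (0, y)) = integral {0..1} (\<lambda>y. \<psi> n (0, y) * pd (1, 0) w (0, y))"
      by (rule integral_cong) (simp add: eq)
    with green_integral_test_fun[OF u \<psi>, of "-1" 0 n] green_integral_test_fun[OF w \<psi>, of 0 1 n]
    show ?thesis by (simp add: \<Omega>_box(1,2) z)
  qed
  moreover have "(\<lambda>n. green_integral \<Omega>m u (\<psi> n) + green_integral \<Omega>p w (\<psi> n)) \<longlonglongrightarrow> green_integral \<Omega>m u \<phi> + green_integral \<Omega>p w \<phi>"
    unfolding \<Omega>_box(1,2)
    by (intro tendsto_add green_integral_tendsto[OF u \<phi> sub(1) s lim] green_integral_tendsto[OF w \<phi> sub(2) s lim])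
  ultimately show "green_integral \<Omega>m u \<phi> + green_integral \<Omega>p w \<phi> = 0"
    by (simp add: LIMSEQ_const_iff)
qed

section \<open>Separated eigenfunctions\<close>

text \<open>
  Phases are kept in both variables because differentiation of the sine shifts the phase by
  \<open>pi / 2\<close>; partial derivatives of modes are then modes again.
\<close>

definition mode :: "complex \<Rightarrow> complex \<Rightarrow> complex \<Rightarrow> complex \<Rightarrow> complex \<Rightarrow> plane \<Rightarrow> complex" where
  "mode c \<gamma> \<theta> \<delta> \<eta> z = c * sin (\<gamma> * of_real (fst z) + \<theta>) * sin (\<delta> * of_real (snd z) + \<eta>)"

lemma smooth_mode: "smooth (mode c \<gamma> \<theta> \<delta> \<eta>)"
proof -
  have "mode c \<gamma> \<theta> \<delta> \<eta> = (\<lambda>z. (c * sin (\<gamma> * of_real (z \<bullet> (1, 0)) + \<theta>)) * sin (\<delta> * of_real (z \<bullet> (0, 1)) + \<eta>))"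
    by (auto simp: mode_def inner_prod_def)
  moreover have "smooth (\<lambda>z::plane. (c * sin (\<gamma> * of_real (z \<bullet> (1, 0)) + \<theta>)) * sin (\<delta> * of_real (z \<bullet> (0, 1)) + \<eta>))"
    by (intro smooth_mult smooth_const smooth_sin smooth_add smooth_lin)
  ultimately show ?thesis by simp
qed

lemma sin_add_half_pi: "sin (z + of_real (pi / 2)) = cos z" for z :: complex
proof -
  have "sin (of_real (pi / 2) :: complex) = 1" "cos (of_real (pi / 2) :: complex) = 0"
    by (simp_all only: sin_of_real cos_of_real sin_pi_half cos_pi_half of_real_1 of_real_0)
  then show ?thesis by (simp only: sin_add) simp
qed

lemma pd_mode:
  "pd (1, 0) (mode c \<gamma> \<theta> \<delta> \<eta>) = mode (c * \<gamma>) \<gamma> (\<theta> + of_real (pi / 2)) \<delta> \<eta>"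
  "pd (0, 1) (mode c \<gamma> \<theta> \<delta> \<eta>) = mode (c * \<delta>) \<gamma> \<theta> \<delta> (\<eta> + of_real (pi / 2))"
proof -
  let ?u = "mode c \<gamma> \<theta> \<delta> \<eta>"
  show "pd (1, 0) ?u = mode (c * \<gamma>) \<gamma> (\<theta> + of_real (pi / 2)) \<delta> \<eta>"
  proof (rule ext, clarify)
    fix x y :: real
    have "((\<lambda>s. c * sin (\<gamma> * s + \<theta>) * sin (\<delta> * of_real y + \<eta>)) has_field_derivative
        c * (cos (\<gamma> * of_real x + \<theta>) * \<gamma>) * sin (\<delta> * of_real y + \<eta>)) (at (of_real x))"
      by (auto intro!: derivative_eq_intros)
    then have "((\<lambda>s. ?u (s, y)) has_vector_derivative
        c * (cos (\<gamma> * of_real x + \<theta>) * \<gamma>) * sin (\<delta> * of_real y + \<eta>)) (at x)"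
      by (auto simp: mode_def dest: has_vector_derivative_real_field)
    with pd_vector_derivative(1)[OF smooth_mode]
    have "pd (1, 0) ?u (x, y) = c * (cos (\<gamma> * of_real x + \<theta>) * \<gamma>) * sin (\<delta> * of_real y + \<eta>)"
      by (rule vector_derivative_unique_at)
    also have "\<dots> = mode (c * \<gamma>) \<gamma> (\<theta> + of_real (pi / 2)) \<delta> \<eta> (x, y)"
      using sin_add_half_pi[of "\<gamma> * of_real x + \<theta>"] by (simp add: mode_def add.assoc)
    finally show "pd (1, 0) ?u (x, y) = mode (c * \<gamma>) \<gamma> (\<theta> + of_real (pi / 2)) \<delta> \<eta> (x, y)" .
  qed
  show "pd (0, 1) ?u = mode (c * \<delta>) \<gamma> \<theta> \<delta> (\<eta> + of_real (pi / 2))"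
  proof (rule ext, clarify)
    fix x y :: real
    have "((\<lambda>s. c * sin (\<gamma> * of_real x + \<theta>) * sin (\<delta> * s + \<eta>)) has_field_derivative
        c * sin (\<gamma> * of_real x + \<theta>) * (cos (\<delta> * of_real y + \<eta>) * \<delta>)) (at (of_real y))"
      by (auto intro!: derivative_eq_intros)
    then have "((\<lambda>s. ?u (x, s)) has_vector_derivative
        c * sin (\<gamma> * of_real x + \<theta>) * (cos (\<delta> * of_real y + \<eta>) * \<delta>)) (at y)"
      by (auto simp: mode_def dest: has_vector_derivative_real_field)
    with pd_vector_derivative(2)[OF smooth_mode]
    have "pd (0, 1) ?u (x, y) = c * sin (\<gamma> * of_real x + \<theta>) * (cos (\<delta> * of_real y + \<eta>) * \<delta>)"
      by (rule vector_derivative_unique_at)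
    also have "\<dots> = mode (c * \<delta>) \<gamma> \<theta> \<delta> (\<eta> + of_real (pi / 2)) (x, y)"
      using sin_add_half_pi[of "\<delta> * of_real y + \<eta>"] by (simp add: mode_def add.assoc)
    finally show "pd (0, 1) ?u (x, y) = mode (c * \<delta>) \<gamma> \<theta> \<delta> (\<eta> + of_real (pi / 2)) (x, y)" .
  qed
qed

lemma laplacian_mode: "laplacian (mode c \<gamma> \<theta> \<delta> \<eta>) z = - (\<gamma>\<^sup>2 + \<delta>\<^sup>2) * mode c \<gamma> \<theta> \<delta> \<eta> z"
proof -
  have cos: "cos (w + of_real (pi / 2)) = - sin w" for w :: complex
  proof -
    have "sin (of_real (pi / 2) :: complex) = 1" "cos (of_real (pi / 2) :: complex) = 0"
      by (simp_all only: sin_of_real cos_of_real sin_pi_half cos_pi_half of_real_1 of_real_0)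
    then show ?thesis by (simp only: cos_add) simp
  qed
  have s: "sin (a + (b + of_real (pi / 2) + of_real (pi / 2))) = - sin (a + b)" for a b :: complex
    using sin_add_half_pi[of "a + b + of_real (pi / 2)"] cos[of "a + b"] by (simp only: add.assoc)
  have "laplacian (mode c \<gamma> \<theta> \<delta> \<eta>) z = pd (1, 0) (pd (1, 0) (mode c \<gamma> \<theta> \<delta> \<eta>)) z + pd (0, 1) (pd (0, 1) (mode c \<gamma> \<theta> \<delta> \<eta>)) z"
    by (simp add: laplacian_def Basis_plane)
  then show ?thesis
    unfolding pd_mode mode_def s by (simp add: power2_eq_square algebra_simps)
qed

definition freq :: "nat \<Rightarrow> complex" where "freq n = of_real (real n * pi)"

text \<open>
  The triple \<open>(u, v, w)\<close> with \<open>u = d sin (\<alpha> (x + 1)) sin (n \<pi> y)\<close>, \<open>v = \<mu> u\<close> and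
  \<open>w = c sin (\<beta> (1 - x)) sin (n \<pi> y)\<close>.
\<close>

definition eigenstate :: "nat \<Rightarrow> complex \<Rightarrow> complex \<Rightarrow> complex \<Rightarrow> complex \<Rightarrow> complex \<Rightarrow> state" where
  "eigenstate n \<mu> \<alpha> \<beta> d c =
    (mode d \<alpha> \<alpha> (freq n) 0, mode (\<mu> * d) \<alpha> \<alpha> (freq n) 0,
     mode c (- \<beta>) \<beta> (freq n) 0)"

lemma cnj_freq: "cnj (freq n) = freq n"
  by (simp add: freq_def)

lemma mode_scale: "mode (k * c) \<gamma> \<theta> \<delta> \<eta> z = k * mode c \<gamma> \<theta> \<delta> \<eta> z"
  by (simp add: mode_def)

lemma zscale_eigenstate: "zscale k (eigenstate n \<mu> \<alpha> \<beta> d c) = eigenstate n \<mu> \<alpha> \<beta> (k * d) (k * c)"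
  by (simp add: eigenstate_def mode_def fun_eq_iff algebra_simps)

lemma sin_freq: "sin (freq n) = 0"
  by (simp only: freq_def sin_of_real sin_npi of_real_0)

lemma mode_H1\<Gamma>:
  shows "mode c \<alpha> \<alpha> (freq n) 0 \<in> H1\<Gamma>m"
    and "mode c (- \<beta>) \<beta> (freq n) 0 \<in> H1\<Gamma>p"
proof -
  have H1: "mode c \<gamma> \<theta> \<delta> \<eta> \<in> H1 \<Omega>m" "mode c \<gamma> \<theta> \<delta> \<eta> \<in> H1 \<Omega>p" for \<gamma> \<theta> \<delta> \<eta>
    by (simp_all add: \<Omega>_box smooth_H1 smooth_mode)
  have T: "has_trace \<Omega>m r s (mode c \<gamma> \<theta> \<delta> \<eta>) (\<lambda>_. 0)" "has_trace \<Omega>p r s (mode c \<gamma> \<theta> \<delta> \<eta>) (\<lambda>_. 0)"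
    if "\<And>t. mode c \<gamma> \<theta> \<delta> \<eta> (linepath r s t) = 0" for r s \<gamma> \<theta> \<delta> \<eta>
    unfolding \<Omega>_box using that by (auto intro!: has_trace_smooth smooth_mode)
  show "mode c \<alpha> \<alpha> (freq n) 0 \<in> H1\<Gamma>m"
    unfolding H1\<Gamma>m_def edges_m_def
    by (auto intro!: H1 T simp: linepath_def mode_def sin_freq)
  show "mode c (- \<beta>) \<beta> (freq n) 0 \<in> H1\<Gamma>p"
    unfolding H1\<Gamma>p_def edges_p_def
    by (auto intro!: H1 T simp: linepath_def mode_def sin_freq)
qed

lemma eigenstate_in_Z: "eigenstate n \<mu> \<alpha> \<beta> d c \<in> Z"
  by (auto simp: Z_def eigenstate_def mode_H1\<Gamma> \<Omega>_box smooth_L2 smooth_mode)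

lemma eigenstate_in_A_dom:
  assumes trace: "\<mu> * d * sin \<alpha> = c * sin \<beta>"
    and normal: "d * \<alpha> * cos \<alpha> = - c * \<beta> * cos \<beta>"
  shows "eigenstate n \<mu> \<alpha> \<beta> d c \<in> A_dom"
proof -
  let ?u = "mode d \<alpha> \<alpha> (freq n) 0" and ?v = "mode (\<mu> * d) \<alpha> \<alpha> (freq n) 0" and ?w = "mode c (- \<beta>) \<beta> (freq n) 0"
  have "same_trace_\<Gamma> ?v ?w"
    unfolding same_trace_\<Gamma>_def
  proof (intro exI conjI)
    let ?g = "\<lambda>t. ?v (0, t)"
    have c: "continuous_on UNIV ?g"
      using smooth_continuous_on[OF smooth_mode] by (rule continuous_on_compose2) (auto intro!: continuous_intros)
    show "has_trace \<Omega>m (0, 0) (0, 1) ?v ?g" "has_trace \<Omega>p (0, 0) (0, 1) ?w ?g"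
      unfolding \<Omega>_box using trace
      by (auto intro!: has_trace_smooth smooth_mode c) (simp_all add: linepath_def mode_def)
  qed
  moreover have "same_normal_trace_\<Gamma> ?u ?w"
    using normal by (intro same_normal_trace_smooth smooth_mode)
      (simp add: pd_mode mode_def sin_add_half_pi del: of_real_divide)
  moreover have "\<exists>g. has_weak_laplacian \<Omega>m ?u g" "\<exists>g. has_weak_laplacian \<Omega>p ?w g"
    unfolding \<Omega>_box using smooth_has_weak_laplacian[OF smooth_mode] by blast+
  moreover have "(?u, ?v, ?w) \<in> Z"
    using eigenstate_in_Z[of n \<mu> \<alpha> \<beta> d c] by (simp add: eigenstate_def)
  ultimately show ?thesis
    by (simp add: A_dom_def Z0_def eigenstate_def mode_H1\<Gamma>)
qed

text \<open>
  Both parts compare \<open>wlap\<close> with the classical Laplacian, for which the modes are eigenfunctions. The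
  second part, at an arbitrary point \<open>\<nu>\<close>, is what the resolvent estimate needs.
\<close>

lemma A_op_eigenstate:
  assumes a: "\<alpha>\<^sup>2 + (freq n)\<^sup>2 = - \<mu>\<^sup>2" and b: "\<beta>\<^sup>2 + (freq n)\<^sup>2 = - \<mu>"
  shows "zeq (A_op (eigenstate n \<mu> \<alpha> \<beta> d c)) (zscale \<mu> (eigenstate n \<mu> \<alpha> \<beta> d c))"
    and "zeq (zdiff (zscale \<nu> (eigenstate n \<mu> \<alpha> \<beta> d c)) (A_op (eigenstate n \<mu> \<alpha> \<beta> d c)))
             (zscale (\<nu> - \<mu>) (eigenstate n \<mu> \<alpha> \<beta> d c))"
proof -
  let ?u = "mode d \<alpha> \<alpha> (freq n) 0" and ?v = "mode (\<mu> * d) \<alpha> \<alpha> (freq n) 0" and ?w = "mode c (- \<beta>) \<beta> (freq n) 0"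
  have "laplacian ?u = (\<lambda>z. \<mu> * ?v z)"
    by (simp add: fun_eq_iff laplacian_mode a mode_scale del: minus_add_distrib) (simp add: power2_eq_square)
  moreover have "laplacian ?w = (\<lambda>z. \<mu> * ?w z)"
    by (simp add: fun_eq_iff laplacian_mode b del: minus_add_distrib)
  ultimately have
    u: "ae_eq \<Omega>m (wlap \<Omega>m ?u) (\<lambda>z. \<mu> * ?v z)" and w: "ae_eq \<Omega>p (wlap \<Omega>p ?w) (\<lambda>z. \<mu> * ?w z)"
    unfolding \<Omega>_box using smooth_wlap[OF smooth_mode] by metis+
  show "zeq (A_op (eigenstate n \<mu> \<alpha> \<beta> d c)) (zscale \<mu> (eigenstate n \<mu> \<alpha> \<beta> d c))"
    using u w by (simp add: eigenstate_def) (simp add: ae_eq_def mode_scale)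
  have "ae_eq \<Omega>m (\<lambda>z. \<nu> * ?v z - wlap \<Omega>m ?u z) (\<lambda>z. (\<nu> - \<mu>) * ?v z)"
    using u unfolding ae_eq_def by eventually_elim (simp add: algebra_simps)
  moreover have "ae_eq \<Omega>p (\<lambda>z. \<nu> * ?w z - wlap \<Omega>p ?w z) (\<lambda>z. (\<nu> - \<mu>) * ?w z)"
    using w unfolding ae_eq_def by eventually_elim (simp add: algebra_simps)
  moreover have "ae_eq \<Omega>m (\<lambda>z. \<nu> * ?u z - ?v z) (\<lambda>z. (\<nu> - \<mu>) * ?u z)"
    by (simp add: ae_eq_def mode_scale algebra_simps)
  ultimately show "zeq (zdiff (zscale \<nu> (eigenstate n \<mu> \<alpha> \<beta> d c)) (A_op (eigenstate n \<mu> \<alpha> \<beta> d c)))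
      (zscale (\<nu> - \<mu>) (eigenstate n \<mu> \<alpha> \<beta> d c))"
    by (simp add: eigenstate_def)
qed

text \<open>
  Homogeneity of the norm. For the gradient part it is not immediate, because \<open>wpd\<close> picks the
  representatives for \<open>u\<close> and for its multiple independently; smoothness of \<open>u\<close> settles this.
\<close>

lemma znorm_zscale:
  assumes "smooth u"
  shows "znorm (zscale k (u, v, w)) = cmod k * znorm (u, v, w)"
proof -
  have "pd b (\<lambda>z. k * u z) = (\<lambda>z. k * pd b u z)" for b
    using pd_mult[OF smooth_const assms, of b k] pd_eqI[of "\<lambda>_::plane. k" "\<lambda>_. 0" _ b] by (intro ext) simp
  then have "(gradnorm \<Omega>m (\<lambda>z. k * u z))\<^sup>2 = (cmod k)\<^sup>2 * (gradnorm \<Omega>m u)\<^sup>2"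
    using smooth_gradnorm[OF smooth_mult[OF smooth_const assms]] smooth_gradnorm[OF assms]
    by (simp add: \<Omega>_box l2norm_scale sum_nonneg power_mult_distrib sum_distrib_left)
  then have "znorm (zscale k (u, v, w)) = sqrt ((cmod k)\<^sup>2 * ((gradnorm \<Omega>m u)\<^sup>2 + (l2norm \<Omega>m v)\<^sup>2 + (l2norm \<Omega>p w)\<^sup>2))"
    by (simp add: l2norm_scale power_mult_distrib algebra_simps)
  then show ?thesis by (simp add: real_sqrt_mult)
qed

lemma continuous_not_ae_zero:
  fixes f :: "'a::euclidean_space \<Rightarrow> complex"
  assumes f: "continuous_on UNIV f" and z: "z \<in> S" "f z \<noteq> 0" and S: "open S"
  shows "\<not> ae_eq S f (\<lambda>_. 0)"
proof
  assume ae: "ae_eq S f (\<lambda>_. 0)"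
  let ?U = "S \<inter> f -` (- {0})"
  have o: "open ?U" using f S by (intro open_Int) (auto intro!: open_vimage)
  have "AE x in lborel. x \<notin> ?U" using ae unfolding ae_eq_def by eventually_elim auto
  then have "?U \<in> null_sets lborel" by (subst AE_iff_null_sets) (use o in auto)
  then have "?U \<in> null_sets lebesgue" by (rule null_sets_completionI)
  with o have "?U = {}" by (metis negligible_iff_null_sets open_not_negligible)
  with z show False by auto
qed

text \<open>
  At the point \<open>(-1/2, 1 / (2 n))\<close> the second sine of \<open>u\<close> equals 1 and the first is \<open>sin (\<alpha> / 2)\<close>.
\<close>

lemma eigenstate_nonzero:
  assumes "n \<ge> 1" "d \<noteq> 0" "sin (\<alpha> / 2) \<noteq> 0"
  shows "\<not> ae_eq \<Omega>m (mode d \<alpha> \<alpha> (freq n) 0) (\<lambda>_. 0)"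
proof (rule continuous_not_ae_zero[OF smooth_continuous_on[OF smooth_mode]])
  show "(-1/2, 1 / (2 * real n)) \<in> \<Omega>m" "open \<Omega>m"
    using assms by (auto simp: \<Omega>m_def field_simps open_Times)
  have "\<alpha> * of_real (-1/2) + \<alpha> = \<alpha> / 2" by simp
  moreover have "freq n * of_real (1 / (2 * real n)) = of_real (pi / 2)"
    using assms(1) by (simp only: freq_def of_real_mult[symmetric]) simp
  moreover have "sin (complex_of_real (pi / 2)) = 1"
    by (simp only: sin_of_real sin_pi_half of_real_1)
  ultimately show "mode d \<alpha> \<alpha> (freq n) 0 (-1/2, 1 / (2 * real n)) \<noteq> 0"
    using assms by (simp only: mode_def fst_conv snd_conv add_0_right mult_1_right) simp
qed

lemma eigenstate_znorm_pos:
  assumes "n \<ge> 1" "d \<noteq> 0" "\<mu> \<noteq> 0" "sin (\<alpha> / 2) \<noteq> 0"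
  shows "znorm (eigenstate n \<mu> \<alpha> \<beta> d c) > 0"
proof -
  let ?v = "mode (\<mu> * d) \<alpha> \<alpha> (freq n) 0"
  have v: "?v \<in> L2 \<Omega>m" unfolding \<Omega>_box by (intro smooth_L2 smooth_mode)
  have "l2norm \<Omega>m ?v \<noteq> 0"
  proof
    assume "l2norm \<Omega>m ?v = 0"
    then have "(LINT z|lborel. indicator \<Omega>m z *\<^sub>R (cmod (?v z))\<^sup>2) = 0"
      by (simp add: l2norm_def set_lebesgue_integral_def)
    moreover have "integrable lborel (\<lambda>z. indicator \<Omega>m z *\<^sub>R (cmod (?v z))\<^sup>2)"
      using v by (simp add: L2_def set_integrable_def)
    ultimately have "AE z in lborel. indicator \<Omega>m z *\<^sub>R (cmod (?v z))\<^sup>2 = 0"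
      by (subst (asm) integral_nonneg_eq_0_iff_AE) auto
    then have "ae_eq \<Omega>m ?v (\<lambda>_. 0)"
      unfolding ae_eq_def by eventually_elim (auto simp: indicator_def)
    with eigenstate_nonzero[of n "\<mu> * d" \<alpha>] assms show False by simp
  qed
  then have "(l2norm \<Omega>m ?v)\<^sup>2 > 0" by simp
  then show ?thesis
    unfolding eigenstate_def znorm.simps real_sqrt_gt_0_iff
    by (intro add_pos_nonneg add_nonneg_pos) auto
qed

text \<open>
  The equation named \<open>char\<close> is the vanishing of the determinant of the two coupling conditions,
  regarded as a linear system for the amplitudes. The last two conditions guarantee that the resulting
  eigenfunction is not zero.
\<close>

locale characteristic_root =
  fixes n :: nat and \<mu> \<alpha> \<beta> :: complex
  assumes n: "n \<ge> 1" and \<mu>: "\<mu> \<noteq> 0"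
    and wave: "\<alpha>\<^sup>2 + (freq n)\<^sup>2 = - \<mu>\<^sup>2"
    and heat: "\<beta>\<^sup>2 + (freq n)\<^sup>2 = - \<mu>"
    and char: "\<alpha> * cos \<alpha> * sin \<beta> + \<mu> * \<beta> * sin \<alpha> * cos \<beta> = 0"
    and nondeg: "sin \<beta> \<noteq> 0" "sin (\<alpha> / 2) \<noteq> 0"
begin

text \<open>
  The amplitudes \<open>(sin \<beta>, \<mu> sin \<alpha>)\<close> solve the first coupling condition identically; the second is then
  the characteristic equation.
\<close>

definition state :: "complex \<Rightarrow> state" where
  "state k = eigenstate n \<mu> \<alpha> \<beta> (k * sin \<beta>) (k * (\<mu> * sin \<alpha>))"

lemma zscale_state: "zscale l (state k) = state (l * k)"
  by (simp add: state_def zscale_eigenstate mult.assoc)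

lemma state_dom: "state k \<in> A_dom"
  unfolding state_def
proof (rule eigenstate_in_A_dom)
  show "\<mu> * (k * sin \<beta>) * sin \<alpha> = k * (\<mu> * sin \<alpha>) * sin \<beta>" by simp
  have "k * (\<alpha> * cos \<alpha> * sin \<beta> + \<mu> * \<beta> * sin \<alpha> * cos \<beta>) = 0" using char by simp
  then show "k * sin \<beta> * \<alpha> * cos \<alpha> = - (k * (\<mu> * sin \<alpha>)) * \<beta> * cos \<beta>"
    by (simp add: algebra_simps eq_neg_iff_add_eq_0)
qed

lemma is_A_eigenvalue: "A_eigenvalue \<mu>"
proof -
  have "\<not> zeq (state 1) zzero"
    using eigenstate_nonzero[OF n nondeg] by (simp add: state_def eigenstate_def zzero_def)
  moreover have "zeq (A_op (state 1)) (zscale \<mu> (state 1))"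
    unfolding state_def by (rule A_op_eigenstate(1)[OF wave heat])
  ultimately show ?thesis unfolding A_eigenvalue_def using state_dom by blast
qed

text \<open>
  On an eigenvector the operator \<open>\<i> Im \<mu> - A\<close> acts as multiplication by \<open>- Re \<mu>\<close>. The eigenvector is
  scaled so that its image has norm exactly 1.
\<close>

lemma opnorm_resolvent_ge:
  assumes "Re \<mu> \<noteq> 0"
  shows "opnorm (A_resolvent (\<i> * of_real (Im \<mu>))) \<ge> ennreal (1 / \<bar>Re \<mu>\<bar>)"
proof -
  define N where "N = znorm (state 1)"
  define k where "k = complex_of_real (1 / (\<bar>Re \<mu>\<bar> * N))"
  have N: "N > 0" unfolding N_def state_def using n \<mu> nondeg by (intro eigenstate_znorm_pos) auto
  have norm: "znorm (state l) = cmod l * N" for l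
  proof -
    have "state l = zscale l (state 1)" by (simp add: zscale_state)
    also have "znorm \<dots> = cmod l * N"
      unfolding N_def state_def eigenstate_def by (rule znorm_zscale[OF smooth_mode])
    finally show ?thesis .
  qed
  let ?\<nu> = "\<i> * of_real (Im \<mu>)"
  have "?\<nu> - \<mu> = - of_real (Re \<mu>)" by (simp add: complex_eq_iff)
  then have c: "cmod (?\<nu> - \<mu>) = \<bar>Re \<mu>\<bar>" by simp
  have ck: "cmod k = 1 / (\<bar>Re \<mu>\<bar> * N)" using N by (simp add: k_def norm_divide norm_mult)
  have "(zscale (?\<nu> - \<mu>) (state k), state k) \<in> A_resolvent ?\<nu>"
    unfolding A_resolvent_def mem_Collect_eq case_prod_conv
  proof (intro conjI state_dom)
    show "zscale (?\<nu> - \<mu>) (state k) \<in> Z" by (simp add: zscale_state) (simp add: state_def eigenstate_in_Z)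
    show "zeq (zdiff (zscale ?\<nu> (state k)) (A_op (state k))) (zscale (?\<nu> - \<mu>) (state k))"
      unfolding state_def by (rule A_op_eigenstate(2)[OF wave heat])
  qed
  moreover have "znorm (zscale (?\<nu> - \<mu>) (state k)) \<le> 1"
    using N assms by (simp add: zscale_state norm norm_mult c ck)
  ultimately have "ennreal (znorm (state k)) \<le> opnorm (A_resolvent ?\<nu>)"
    unfolding opnorm_def by (intro SUP_upper2[of "(zscale (?\<nu> - \<mu>) (state k), state k)"]) auto
  moreover have "znorm (state k) = 1 / \<bar>Re \<mu>\<bar>" using N by (simp add: norm ck)
  ultimately show ?thesis by simp
qed

end

text \<open>
  The characteristic equations have real coefficients.
\<close>

lemma characteristic_root_cnj:
  assumes "characteristic_root n \<mu> \<alpha> \<beta>"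
  shows "characteristic_root n (cnj \<mu>) (cnj \<alpha>) (cnj \<beta>)"
proof -
  interpret characteristic_root n \<mu> \<alpha> \<beta> by fact
  show ?thesis
  proof
    show "(cnj \<alpha>)\<^sup>2 + (freq n)\<^sup>2 = - (cnj \<mu>)\<^sup>2"
      using arg_cong[OF wave, of cnj] by (simp add: cnj_freq)
    show "(cnj \<beta>)\<^sup>2 + (freq n)\<^sup>2 = - cnj \<mu>"
      using arg_cong[OF heat, of cnj] by (simp add: cnj_freq)
    show "cnj \<alpha> * cos (cnj \<alpha>) * sin (cnj \<beta>) + cnj \<mu> * cnj \<beta> * sin (cnj \<alpha>) * cos (cnj \<beta>) = 0"
      using arg_cong[OF char, of cnj] by (simp add: cnj_sin cnj_cos)
    show "sin (cnj \<beta>) \<noteq> 0" "sin (cnj \<alpha> / 2) \<noteq> 0"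
      using nondeg cnj_sin[of \<beta>] cnj_sin[of "\<alpha> / 2"] by (metis complex_cnj_zero_iff, metis complex_cnj_zero_iff complex_cnj_divide complex_cnj_numeral)
  qed (use n \<mu> in auto)
qed

section \<open>Asymptotics of the characteristic equation\<close>

text \<open>
  A statement about all points of \<open>K\<close> for large \<open>k\<close> follows from its validity along every sequence in
  \<open>K\<close>: otherwise a sequence of counterexamples could be selected. This allows uniform estimates to be
  read off from ordinary limits of sequences.
\<close>

lemma eventually_uniformI:
  assumes "K \<noteq> {}" and ev: "\<And>z. (\<And>k. z k \<in> K) \<Longrightarrow> eventually (\<lambda>k. P k (z k)) F"
  shows "eventually (\<lambda>k. \<forall>\<zeta>\<in>K. P k \<zeta>) F"
proof -
  obtain \<zeta>0 where "\<zeta>0 \<in> K" using assms(1) by blast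
  define z where "z k = (if \<exists>\<zeta>\<in>K. \<not> P k \<zeta> then SOME \<zeta>. \<zeta> \<in> K \<and> \<not> P k \<zeta> else \<zeta>0)" for k
  have z: "z k \<in> K \<and> ((\<exists>\<zeta>\<in>K. \<not> P k \<zeta>) \<longrightarrow> \<not> P k (z k))" for k
  proof (cases "\<exists>\<zeta>\<in>K. \<not> P k \<zeta>")
    case True
    then obtain \<zeta> where "\<zeta> \<in> K \<and> \<not> P k \<zeta>" by blast
    from someI[of "\<lambda>\<zeta>. \<zeta> \<in> K \<and> \<not> P k \<zeta>", OF this] True show ?thesis by (simp add: z_def)
  next
    case False
    then show ?thesis by (simp add: z_def \<open>\<zeta>0 \<in> K\<close>)
  qed
  from z have "eventually (\<lambda>k. P k (z k)) F" by (intro ev) blast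
  then show ?thesis by eventually_elim (use z in blast)
qed

text \<open>
  The unknown \<open>\<zeta>\<close> is the deviation of \<open>\<alpha>\<close> from \<open>\<pi>\<close>, rescaled to be of order 1. The next two definitions
  solve the equations \<open>\<alpha>\<^sup>2 + k\<^sup>2 \<pi>\<^sup>2 = - \<lambda>\<^sup>2\<close> and \<open>\<beta>\<^sup>2 + k\<^sup>2 \<pi>\<^sup>2 = - \<lambda>\<close> for \<open>\<lambda>\<close> and \<open>\<beta>\<close>, on the branch in the upper
  half plane. The factor \<open>k\<close> is pulled out of the square roots to keep their arguments near
  \<open>\<pi>\<^sup>2\<close>, away from the branch cut.
\<close>

definition wave_number :: "nat \<Rightarrow> complex \<Rightarrow> complex" where
  "wave_number k \<zeta> = of_real pi + \<zeta> / (of_nat k)\<^sup>2"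

definition trial_eigenvalue :: "nat \<Rightarrow> complex \<Rightarrow> complex" where
  "trial_eigenvalue k \<zeta> = \<i> * of_nat k * csqrt (of_real (pi\<^sup>2) + (wave_number k \<zeta> / of_nat k)\<^sup>2)"

definition heat_number :: "nat \<Rightarrow> complex \<Rightarrow> complex" where
  "heat_number k \<zeta> = \<i> * of_nat k * csqrt (of_real (pi\<^sup>2) + trial_eigenvalue k \<zeta> / (of_nat k)\<^sup>2)"

text \<open>
  With \<open>\<delta> = \<zeta> / k\<^sup>2\<close>, the characteristic equation reads \<open>sin \<delta> = - cos \<delta> (\<alpha> sin \<beta>) / (\<lambda> \<beta> cos \<beta>)\<close>.
  Adding \<open>\<delta> - sin \<delta>\<close>, which is of smaller order, to both sides and multiplying by \<open>k\<^sup>2\<close> gives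
  \<open>\<zeta> = fixmap k \<zeta>\<close>.
\<close>

definition fixmap :: "nat \<Rightarrow> complex \<Rightarrow> complex" where
  "fixmap k \<zeta> = (of_nat k)\<^sup>2 * (\<zeta> / (of_nat k)\<^sup>2 - sin (\<zeta> / (of_nat k)\<^sup>2)
     - cos (\<zeta> / (of_nat k)\<^sup>2) * (wave_number k \<zeta> * sin (heat_number k \<zeta>)) / (trial_eigenvalue k \<zeta> * heat_number k \<zeta> * cos (heat_number k \<zeta>)))"

lemma wave_equation: "k \<ge> 1 \<Longrightarrow> (wave_number k \<zeta>)\<^sup>2 + (freq k)\<^sup>2 = - (trial_eigenvalue k \<zeta>)\<^sup>2"
  and heat_equation: "k \<ge> 1 \<Longrightarrow> (heat_number k \<zeta>)\<^sup>2 + (freq k)\<^sup>2 = - trial_eigenvalue k \<zeta>"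
  by (simp_all add: trial_eigenvalue_def[of k \<zeta>] heat_number_def power_mult_distrib freq_def power_divide field_simps)

lemma fixmap_characteristic:
  assumes "k \<ge> 1" and fixed: "fixmap k \<zeta> = \<zeta>" and nz: "trial_eigenvalue k \<zeta> \<noteq> 0" "heat_number k \<zeta> \<noteq> 0" "cos (heat_number k \<zeta>) \<noteq> 0"
  shows "wave_number k \<zeta> * cos (wave_number k \<zeta>) * sin (heat_number k \<zeta>) + trial_eigenvalue k \<zeta> * heat_number k \<zeta> * sin (wave_number k \<zeta>) * cos (heat_number k \<zeta>) = 0"
proof -
  define \<delta> where "\<delta> = \<zeta> / (of_nat k)\<^sup>2"
  define D where "D = trial_eigenvalue k \<zeta> * heat_number k \<zeta> * cos (heat_number k \<zeta>)"
  have D: "D \<noteq> 0" using nz by (simp add: D_def)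
  have k: "(of_nat k)\<^sup>2 \<noteq> (0 :: complex)" using assms(1) by simp
  have "(of_nat k)\<^sup>2 * \<delta> = (of_nat k)\<^sup>2 * (\<delta> - sin \<delta> - cos \<delta> * (wave_number k \<zeta> * sin (heat_number k \<zeta>)) / D)"
    using fixed k by (simp add: fixmap_def \<delta>_def D_def)
  then have "\<delta> = \<delta> - sin \<delta> - cos \<delta> * (wave_number k \<zeta> * sin (heat_number k \<zeta>)) / D"
    using k by (simp only: mult_cancel_left) simp
  then have s: "sin \<delta> * D + cos \<delta> * (wave_number k \<zeta> * sin (heat_number k \<zeta>)) = 0"
    using D by (simp add: field_simps)
  have "sin (wave_number k \<zeta>) = - sin \<delta>" "cos (wave_number k \<zeta>) = - cos \<delta>"
    by (simp_all add: wave_number_def \<delta>_def[symmetric] sin_add cos_add sin_of_real cos_of_real)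
  then have "wave_number k \<zeta> * cos (wave_number k \<zeta>) * sin (heat_number k \<zeta>) + trial_eigenvalue k \<zeta> * heat_number k \<zeta> * sin (wave_number k \<zeta>) * cos (heat_number k \<zeta>)
      = - (sin \<delta> * D + cos \<delta> * (wave_number k \<zeta> * sin (heat_number k \<zeta>)))"
    by (simp add: D_def algebra_simps)
  with s show ?thesis by simp
qed

text \<open>
  Written in terms of \<open>exp (2 * \<i> * b)\<close>, which tends to 0 as \<open>Im b\<close> grows, so that the quotient tends to
  \<open>\<i>\<close>.
\<close>

lemma sin_over_cos_exp:
  assumes "exp (2 * \<i> * b) + 1 \<noteq> 0"
  shows "cos b \<noteq> 0" "sin b / cos b = - \<i> * (exp (2 * \<i> * b) - 1) / (exp (2 * \<i> * b) + 1)"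
proof -
  define e where "e = exp (\<i> * b)"
  have e: "e \<noteq> 0" by (simp add: e_def)
  have E: "exp (2 * \<i> * b) = e * e" by (simp add: e_def exp_add[symmetric] algebra_simps)
  have c: "cos b = (e * e + 1) / (2 * e)" "sin b = (e * e - 1) / (2 * \<i> * e)"
    using e by (simp_all add: cos_exp_eq sin_exp_eq exp_minus e_def[symmetric] field_simps)
  have nz: "e * e + 1 \<noteq> 0" using assms unfolding E .
  show "cos b \<noteq> 0" unfolding c using e nz by simp
  show "sin b / cos b = - \<i> * (exp (2 * \<i> * b) - 1) / (exp (2 * \<i> * b) + 1)"
    unfolding c E using e nz by (simp add: divide_simps)
qed

lemma sin_minus_id_bound: "cmod (sin z - z) \<le> exp \<bar>Im z\<bar> * (cmod z)\<^sup>2"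
  using Taylor_sin[of z 1] by (simp add: sin_coeff_def numeral_2_eq_2)

lemma inverse_square_tendsto: "(\<lambda>k. c / (real k)\<^sup>2) \<longlonglongrightarrow> 0"
proof -
  have "(\<lambda>k. c * (1 / real k)\<^sup>2) \<longlonglongrightarrow> c * 0\<^sup>2" by (intro tendsto_intros lim_1_over_n)
  then show ?thesis by (simp add: power_divide)
qed

lemma csqrt_pi2_tendsto:
  assumes "f \<longlonglongrightarrow> 0"
  shows "(\<lambda>k. csqrt (of_real (pi\<^sup>2) + f k)) \<longlonglongrightarrow> of_real pi"
proof -
  have "(\<lambda>k. of_real (pi\<^sup>2) + f k) \<longlonglongrightarrow> of_real (pi\<^sup>2)"
    using tendsto_add[OF tendsto_const assms, of "of_real (pi\<^sup>2)"] by simp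
  moreover have "isCont csqrt (of_real (pi\<^sup>2))"
    by (intro continuous_at_csqrt) (auto simp: complex_nonpos_Reals_iff)
  ultimately have "(\<lambda>k. csqrt (of_real (pi\<^sup>2) + f k)) \<longlonglongrightarrow> csqrt (of_real (pi\<^sup>2))"
    using isCont_tendsto_compose by blast
  then show ?thesis by (simp add: csqrt_of_real_nonneg)
qed

lemma inverse_nat_tendsto: "(\<lambda>k. 1 / of_nat k :: complex) \<longlonglongrightarrow> 0"
  using lim_1_over_n by blast

text \<open>
  Limits along an arbitrary bounded sequence of values of the rescaled unknown.
\<close>

context
  fixes z :: "nat \<Rightarrow> complex" and M :: real
  assumes bounded: "\<And>k. cmod (z k) \<le> M"
begin

lemma delta_tendsto: "(\<lambda>k. z k / (of_nat k)\<^sup>2) \<longlonglongrightarrow> 0"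
proof (rule Lim_null_comparison)
  show "\<forall>\<^sub>F k in sequentially. norm (z k / (of_nat k)\<^sup>2) \<le> M / (real k)\<^sup>2"
    using bounded by (intro always_eventually) (simp add: norm_divide norm_power divide_right_mono)
  show "(\<lambda>k. M / (real k)\<^sup>2) \<longlonglongrightarrow> 0" by (rule inverse_square_tendsto)
qed

lemma wave_number_tendsto: "(\<lambda>k. wave_number k (z k)) \<longlonglongrightarrow> of_real pi"
  using tendsto_add[OF tendsto_const delta_tendsto] by (simp add: wave_number_def)

lemma wave_number_sq_tendsto: "(\<lambda>k. (wave_number k (z k) / of_nat k)\<^sup>2) \<longlonglongrightarrow> 0"
  using tendsto_power[OF tendsto_mult[OF wave_number_tendsto inverse_nat_tendsto], of 2] by simp

lemma trial_eigenvalue_tendsto: "(\<lambda>k. trial_eigenvalue k (z k) / of_nat k) \<longlonglongrightarrow> \<i> * of_real pi"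
proof -
  have "(\<lambda>k. \<i> * csqrt (of_real (pi\<^sup>2) + (wave_number k (z k) / of_nat k)\<^sup>2)) \<longlonglongrightarrow> \<i> * of_real pi"
    by (intro tendsto_mult tendsto_const csqrt_pi2_tendsto wave_number_sq_tendsto)
  then show ?thesis
    by (rule Lim_transform_eventually) (auto simp: trial_eigenvalue_def intro: eventually_sequentiallyI[of 1])
qed

lemma trial_eigenvalue_sq_tendsto: "(\<lambda>k. trial_eigenvalue k (z k) / (of_nat k)\<^sup>2) \<longlonglongrightarrow> 0"
  using tendsto_mult[OF trial_eigenvalue_tendsto inverse_nat_tendsto] by (simp add: power2_eq_square)

lemma heat_number_tendsto: "(\<lambda>k. heat_number k (z k) / of_nat k) \<longlonglongrightarrow> \<i> * of_real pi"
proof -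
  have "(\<lambda>k. \<i> * csqrt (of_real (pi\<^sup>2) + trial_eigenvalue k (z k) / (of_nat k)\<^sup>2)) \<longlonglongrightarrow> \<i> * of_real pi"
    by (intro tendsto_mult tendsto_const csqrt_pi2_tendsto trial_eigenvalue_sq_tendsto)
  then show ?thesis
    by (rule Lim_transform_eventually) (auto simp: heat_number_def intro: eventually_sequentiallyI[of 1])
qed

lemma exp_heat_number_tendsto: "(\<lambda>k. exp (2 * \<i> * heat_number k (z k))) \<longlonglongrightarrow> 0"
proof -
  have "(\<lambda>k. Im (heat_number k (z k) / of_nat k)) \<longlonglongrightarrow> pi"
    using tendsto_Im[OF heat_number_tendsto] by simp
  then have "filterlim (\<lambda>k. Im (heat_number k (z k) / of_nat k) * real k) at_top sequentially"
    by (rule filterlim_tendsto_pos_mult_at_top) (auto intro: filterlim_real_sequentially)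
  then have "filterlim (\<lambda>k. 2 * (Im (heat_number k (z k) / of_nat k) * real k)) at_top sequentially"
    by (rule filterlim_tendsto_pos_mult_at_top[OF tendsto_const, rotated]) simp
  then have "(\<lambda>k. exp (- (2 * (Im (heat_number k (z k) / of_nat k) * real k)))) \<longlonglongrightarrow> 0"
    by (intro filterlim_compose[OF exp_at_bot]) (simp add: filterlim_uminus_at_bot)
  moreover have "\<forall>\<^sub>F k in sequentially. exp (- (2 * (Im (heat_number k (z k) / of_nat k) * real k))) = norm (exp (2 * \<i> * heat_number k (z k)))"
    by (rule eventually_sequentiallyI[of 1]) (simp add: norm_exp_eq_Re)
  ultimately have "(\<lambda>k. norm (exp (2 * \<i> * heat_number k (z k)))) \<longlonglongrightarrow> 0"
    by (rule Lim_transform_eventually)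
  then show ?thesis by (rule tendsto_norm_zero_cancel)
qed

lemma tan_heat_number_tendsto: "(\<lambda>k. sin (heat_number k (z k)) / cos (heat_number k (z k))) \<longlonglongrightarrow> \<i>"
  and cos_heat_number_nonzero: "\<forall>\<^sub>F k in sequentially. cos (heat_number k (z k)) \<noteq> 0"
proof -
  let ?E = "\<lambda>k. exp (2 * \<i> * heat_number k (z k))"
  have 1: "(\<lambda>k. ?E k + 1) \<longlonglongrightarrow> 1" using tendsto_add[OF exp_heat_number_tendsto tendsto_const, of 1] by simp
  then have nz: "\<forall>\<^sub>F k in sequentially. ?E k + 1 \<noteq> 0" by (rule tendsto_imp_eventually_ne) simp
  then show "\<forall>\<^sub>F k in sequentially. cos (heat_number k (z k)) \<noteq> 0"
    by eventually_elim (rule sin_over_cos_exp)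
  have "(\<lambda>k. - \<i> * (?E k - 1) / (?E k + 1)) \<longlonglongrightarrow> - \<i> * (0 - 1) / 1"
    by (intro tendsto_divide tendsto_mult tendsto_diff tendsto_const exp_heat_number_tendsto 1) simp
  then have "(\<lambda>k. - \<i> * (?E k - 1) / (?E k + 1)) \<longlonglongrightarrow> \<i>" by simp
  then show "(\<lambda>k. sin (heat_number k (z k)) / cos (heat_number k (z k))) \<longlonglongrightarrow> \<i>"
    by (rule Lim_transform_eventually) (use nz in \<open>eventually_elim, simp add: sin_over_cos_exp\<close>)
qed

lemma fixmap_tendsto: "(\<lambda>k. fixmap k (z k)) \<longlonglongrightarrow> \<i> / of_real pi"
proof -
  let ?d = "\<lambda>k. z k / (of_nat k)\<^sup>2"
  have "(\<lambda>k. (of_nat k)\<^sup>2 * (?d k - sin (?d k))) \<longlonglongrightarrow> 0"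
  proof (rule Lim_null_comparison)
    show "\<forall>\<^sub>F k in sequentially. norm ((of_nat k)\<^sup>2 * (?d k - sin (?d k))) \<le> exp \<bar>Im (?d k)\<bar> * (M\<^sup>2 / (real k)\<^sup>2)"
    proof (rule eventually_sequentiallyI[of 1])
      fix k :: nat assume k: "1 \<le> k"
      have "norm ((of_nat k)\<^sup>2 * (?d k - sin (?d k))) = (real k)\<^sup>2 * cmod (sin (?d k) - ?d k)"
        by (simp add: norm_mult norm_power norm_minus_commute)
      also have "\<dots> \<le> (real k)\<^sup>2 * (exp \<bar>Im (?d k)\<bar> * (cmod (?d k))\<^sup>2)"
        by (intro mult_left_mono sin_minus_id_bound) simp
      also have "\<dots> = exp \<bar>Im (?d k)\<bar> * ((cmod (z k))\<^sup>2 / (real k)\<^sup>2)"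
      proof -
        have "K * (X * (c / K)\<^sup>2) = X * (c\<^sup>2 / K)" if "K \<noteq> 0" for K X c :: real
          using that by (simp add: power2_eq_square)
        then show ?thesis using k by (simp add: norm_divide norm_power)
      qed
      also have "\<dots> \<le> exp \<bar>Im (?d k)\<bar> * (M\<^sup>2 / (real k)\<^sup>2)"
        using bounded by (intro mult_left_mono divide_right_mono power_mono) auto
      finally show "norm ((of_nat k)\<^sup>2 * (?d k - sin (?d k))) \<le> exp \<bar>Im (?d k)\<bar> * (M\<^sup>2 / (real k)\<^sup>2)" .
    qed
    have "(\<lambda>k. exp \<bar>Im (?d k)\<bar>) \<longlonglongrightarrow> exp \<bar>Im 0\<bar>"
      by (intro tendsto_intros delta_tendsto)
    moreover have "(\<lambda>k. M\<^sup>2 / (real k)\<^sup>2) \<longlonglongrightarrow> 0" by (rule inverse_square_tendsto)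
    ultimately show "(\<lambda>k. exp \<bar>Im (?d k)\<bar> * (M\<^sup>2 / (real k)\<^sup>2)) \<longlonglongrightarrow> 0"
      using tendsto_mult by fastforce
  qed
  moreover have "(\<lambda>k. cos (?d k) * wave_number k (z k) * (sin (heat_number k (z k)) / cos (heat_number k (z k))) /
      ((trial_eigenvalue k (z k) / of_nat k) * (heat_number k (z k) / of_nat k)))
      \<longlonglongrightarrow> cos 0 * of_real pi * \<i> / ((\<i> * of_real pi) * (\<i> * of_real pi))"
    by (intro tendsto_intros delta_tendsto wave_number_tendsto tan_heat_number_tendsto trial_eigenvalue_tendsto heat_number_tendsto) auto
  ultimately have "(\<lambda>k. (of_nat k)\<^sup>2 * (?d k - sin (?d k)) - cos (?d k) * wave_number k (z k) * (sin (heat_number k (z k)) / cos (heat_number k (z k))) /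
      ((trial_eigenvalue k (z k) / of_nat k) * (heat_number k (z k) / of_nat k)))
      \<longlonglongrightarrow> 0 - cos 0 * of_real pi * \<i> / ((\<i> * of_real pi) * (\<i> * of_real pi))"
    by (rule tendsto_diff)
  moreover have "0 - cos 0 * of_real pi * \<i> / ((\<i> * of_real pi) * (\<i> * of_real pi)) = \<i> / complex_of_real pi"
    by (simp add: field_simps)
  ultimately have lim: "(\<lambda>k. (of_nat k)\<^sup>2 * (?d k - sin (?d k)) - cos (?d k) * wave_number k (z k) * (sin (heat_number k (z k)) / cos (heat_number k (z k))) /
      ((trial_eigenvalue k (z k) / of_nat k) * (heat_number k (z k) / of_nat k))) \<longlonglongrightarrow> \<i> / complex_of_real pi"
    by simp
  \<comment> \<open>distributes the factor \<open>k\<^sup>2\<close> over the terms whose limits are known\<close>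
  have regroup: "K * (x - y - C * (A * S) / (m * b * c)) = K * (x - y) - C * A * (S / c) / (m / k * (b / k))"
    if "K = k\<^sup>2" "k \<noteq> 0" for K x y C A S m b c k :: complex
    using that by (cases "m * b * c = 0") (auto simp: field_simps power2_eq_square)
  show ?thesis
    by (rule Lim_transform_eventually[OF lim eventually_sequentiallyI[of 1]])
      (simp add: fixmap_def regroup[OF refl])
qed

end

section \<open>Existence of characteristic roots\<close>

text \<open>
  The ball around the limit of \<open>fixmap\<close> is small enough to stay in the open upper half plane, which
  forces \<open>Im \<alpha> > 0\<close> and hence \<open>Re \<lambda> < 0\<close>.
\<close>

definition root_region :: "complex set" where
  "root_region = cball (\<i> / of_real pi) (1 / (2 * pi))"

lemma root_region_bounds:
  assumes "\<zeta> \<in> root_region"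
  shows "1 / (2 * pi) \<le> Im \<zeta>" "Im \<zeta> \<le> 1" "\<bar>Re \<zeta>\<bar> \<le> 1" "cmod \<zeta> \<le> 2"
proof -
  have p: "1 / pi \<le> 1 / 2" using pi_gt3 by (intro divide_left_mono) auto
  have d: "cmod (\<zeta> - \<i> / of_real pi) \<le> 1 / (2 * pi)"
    using assms by (simp add: root_region_def dist_norm norm_minus_commute)
  have I: "Im (\<i> / of_real pi) = 1 / pi" "Re (\<i> / of_real pi) = 0" by simp_all
  have "\<bar>Im \<zeta> - 1 / pi\<bar> \<le> 1 / (2 * pi)" "\<bar>Re \<zeta>\<bar> \<le> 1 / (2 * pi)"
    using abs_Im_le_cmod[of "\<zeta> - \<i> / of_real pi"] abs_Re_le_cmod[of "\<zeta> - \<i> / of_real pi"] d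
    unfolding minus_complex.sel I by linarith+
  moreover have "1 / pi = 1 / (2 * pi) + 1 / (2 * pi)" by (simp add: field_simps)
  ultimately show "1 / (2 * pi) \<le> Im \<zeta>" "Im \<zeta> \<le> 1" "\<bar>Re \<zeta>\<bar> \<le> 1" using p by linarith+
  moreover have "0 < 1 / (2 * pi)" by simp
  ultimately show "cmod \<zeta> \<le> 2" using cmod_le[of \<zeta>] by linarith
qed

lemma eventually_root_region:
  assumes "\<And>z. (\<And>k. cmod (z k) \<le> 2) \<Longrightarrow> eventually (\<lambda>k. P k (z k)) sequentially"
  shows "\<forall>\<^sub>F k in sequentially. \<forall>\<zeta>\<in>root_region. P k \<zeta>"
proof (rule eventually_uniformI)
  show "root_region \<noteq> {}" by (auto simp: root_region_def)
  show "eventually (\<lambda>k. P k (z k)) sequentially" if "\<And>k. z k \<in> root_region" for z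
    using that root_region_bounds(4) by (intro assms) blast
qed

text \<open>
  The constants 3 and 4 enclose \<open>pi\<close>, the limit of \<open>Im \<lambda> / k\<close>.
\<close>

lemma eventually_nondegenerate:
  "\<forall>\<^sub>F k in sequentially. \<forall>\<zeta>\<in>root_region. cos (heat_number k \<zeta>) \<noteq> 0 \<and> sin (heat_number k \<zeta>) \<noteq> 0 \<and> sin (wave_number k \<zeta> / 2) \<noteq> 0
     \<and> heat_number k \<zeta> \<noteq> 0 \<and> 3 * real k \<le> Im (trial_eigenvalue k \<zeta>) \<and> Im (trial_eigenvalue k \<zeta>) \<le> 4 * real k"
proof (rule eventually_root_region)
  fix z :: "nat \<Rightarrow> complex" assume z: "\<And>k. cmod (z k) \<le> 2"
  have "\<forall>\<^sub>F k in sequentially. sin (heat_number k (z k)) / cos (heat_number k (z k)) \<noteq> 0"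
    using tan_heat_number_tendsto[OF z] by (rule tendsto_imp_eventually_ne) simp
  moreover note cos_heat_number_nonzero[OF z]
  moreover have "\<forall>\<^sub>F k in sequentially. heat_number k (z k) / of_nat k \<noteq> 0"
    using heat_number_tendsto[OF z] by (rule tendsto_imp_eventually_ne) simp
  moreover have "\<forall>\<^sub>F k in sequentially. sin (wave_number k (z k) / 2) \<noteq> 0"
  proof (rule tendsto_imp_eventually_ne)
    show "(\<lambda>k. sin (wave_number k (z k) / 2)) \<longlonglongrightarrow> sin (of_real pi / 2)"
      by (intro tendsto_intros wave_number_tendsto[OF z]) simp
    have "complex_of_real pi / 2 = of_real (pi / 2)" by simp
    then show "sin (complex_of_real pi / 2) \<noteq> 0" by (simp only: sin_of_real sin_pi_half of_real_1) simp
  qed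
  moreover have m: "(\<lambda>k. Im (trial_eigenvalue k (z k) / of_nat k)) \<longlonglongrightarrow> pi"
    using tendsto_Im[OF trial_eigenvalue_tendsto[OF z]] by simp
  have "\<forall>\<^sub>F k in sequentially. 3 < Im (trial_eigenvalue k (z k) / of_nat k)" using order_tendstoD(1)[OF m pi_gt3] .
  moreover have "\<forall>\<^sub>F k in sequentially. Im (trial_eigenvalue k (z k) / of_nat k) < 4" using order_tendstoD(2)[OF m pi_less_4] .
  moreover have "\<forall>\<^sub>F k::nat in sequentially. k \<ge> 1" by (rule eventually_ge_at_top)
  ultimately show "\<forall>\<^sub>F k in sequentially. cos (heat_number k (z k)) \<noteq> 0 \<and> sin (heat_number k (z k)) \<noteq> 0 \<and> sin (wave_number k (z k) / 2) \<noteq> 0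
     \<and> heat_number k (z k) \<noteq> 0 \<and> 3 * real k \<le> Im (trial_eigenvalue k (z k)) \<and> Im (trial_eigenvalue k (z k)) \<le> 4 * real k"
    by eventually_elim (auto simp: field_simps)
qed

lemma eventually_fixmap_continuous:
  "\<forall>\<^sub>F k in sequentially. continuous_on root_region (fixmap k)"
proof -
  have "\<forall>\<^sub>F k in sequentially. \<forall>\<zeta>\<in>root_region.
      Re (of_real (pi\<^sup>2) + (wave_number k \<zeta> / of_nat k)\<^sup>2) > 0 \<and> Re (of_real (pi\<^sup>2) + trial_eigenvalue k \<zeta> / (of_nat k)\<^sup>2) > 0"
  proof (rule eventually_root_region)
    fix z :: "nat \<Rightarrow> complex" assume z: "\<And>k. cmod (z k) \<le> 2"
    have pos: "\<forall>\<^sub>F k in sequentially. Re (of_real (pi\<^sup>2) + f k) > 0" if "f \<longlonglongrightarrow> 0" for f :: "nat \<Rightarrow> complex"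
    proof (rule order_tendstoD(1))
      show "(\<lambda>k. Re (of_real (pi\<^sup>2) + f k)) \<longlonglongrightarrow> Re (of_real (pi\<^sup>2) + 0)"
        by (intro tendsto_intros that)
    qed simp
    from pos[OF wave_number_sq_tendsto[OF z]] pos[OF trial_eigenvalue_sq_tendsto[OF z]]
    show "\<forall>\<^sub>F k in sequentially. Re (of_real (pi\<^sup>2) + (wave_number k (z k) / of_nat k)\<^sup>2) > 0
        \<and> Re (of_real (pi\<^sup>2) + trial_eigenvalue k (z k) / (of_nat k)\<^sup>2) > 0"
      by (rule eventually_conj)
  qed
  moreover note eventually_nondegenerate eventually_ge_at_top[of "1 :: nat"]
  ultimately show ?thesis
  proof eventually_elim
    case (elim k)
    have csqrt: "continuous_on root_region (\<lambda>\<zeta>. csqrt (f \<zeta>))"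
      if "continuous_on root_region f" "\<And>\<zeta>. \<zeta> \<in> root_region \<Longrightarrow> Re (f \<zeta>) > 0" for f
    proof (rule continuous_on_compose2[of "{w. Re w > 0}" csqrt])
      show "continuous_on {w. Re w > 0} csqrt" by (intro continuous_at_imp_continuous_on ballI continuous_at_csqrt) (auto simp: complex_nonpos_Reals_iff)
    qed (use that in auto)
    have pos: "Re (of_real (pi\<^sup>2) + (wave_number k \<zeta> / of_nat k)\<^sup>2) > 0" "Re (of_real (pi\<^sup>2) + trial_eigenvalue k \<zeta> / (of_nat k)\<^sup>2) > 0"
      if "\<zeta> \<in> root_region" for \<zeta> using elim(1) that by blast+
    have wave_number: "continuous_on root_region (wave_number k)"
      unfolding wave_number_def by (intro continuous_intros) (use elim(3) in simp_all)
    have trial_eigenvalue: "continuous_on root_region (trial_eigenvalue k)"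
      unfolding trial_eigenvalue_def by (intro continuous_intros csqrt wave_number pos) (use elim(3) in simp_all)
    have heat_number: "continuous_on root_region (heat_number k)"
      unfolding heat_number_def by (intro continuous_intros csqrt trial_eigenvalue pos) (use elim(3) in simp_all)
    have nz: "trial_eigenvalue k \<zeta> * heat_number k \<zeta> * cos (heat_number k \<zeta>) \<noteq> 0" if "\<zeta> \<in> root_region" for \<zeta>
    proof -
      have "3 * real k \<le> Im (trial_eigenvalue k \<zeta>)" using elim(2) that by blast
      with elim(3) have "trial_eigenvalue k \<zeta> \<noteq> 0" by auto
      moreover have "heat_number k \<zeta> \<noteq> 0" "cos (heat_number k \<zeta>) \<noteq> 0" using elim(2) that by blast+
      ultimately show ?thesis by simp
    qed
    show ?case
      unfolding fixmap_def by (intro continuous_intros wave_number trial_eigenvalue heat_number ballI nz) (use elim(3) in simp_all)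
  qed
qed

lemma eventually_fixmap_into: "\<forall>\<^sub>F k in sequentially. fixmap k \<in> root_region \<rightarrow> root_region"
proof -
  have "\<forall>\<^sub>F k in sequentially. \<forall>\<zeta>\<in>root_region. fixmap k \<zeta> \<in> root_region"
  proof (rule eventually_root_region)
    fix z :: "nat \<Rightarrow> complex" assume z: "\<And>k. cmod (z k) \<le> 2"
    have "\<forall>\<^sub>F k in sequentially. dist (fixmap k (z k)) (\<i> / of_real pi) < 1 / (2 * pi)"
      using fixmap_tendsto[OF z] by (rule tendstoD) simp
    then show "\<forall>\<^sub>F k in sequentially. fixmap k (z k) \<in> root_region"
      by eventually_elim (simp add: root_region_def dist_commute)
  qed
  then show ?thesis by eventually_elim auto
qed

text \<open>
  The imaginary part of \<open>\<lambda>\<^sup>2 = - \<alpha>\<^sup>2 - k\<^sup>2 \<pi>\<^sup>2\<close> gives \<open>Re \<lambda> Im \<lambda> = - Re \<alpha> Im \<alpha>\<close>. Here \<open>Re \<alpha> \<le> 5\<close>, and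
  \<open>Im \<alpha> \<le> 1 / k\<^sup>2 \<le> 16 / (Im \<lambda>)\<^sup>2\<close>; the constant is \<open>80 = 5 * 16\<close>.
\<close>

lemma Re_trial_eigenvalue_bounds:
  assumes k: "k \<ge> 1" and \<zeta>: "\<zeta> \<in> root_region" and Im: "3 * real k \<le> Im (trial_eigenvalue k \<zeta>)" "Im (trial_eigenvalue k \<zeta>) \<le> 4 * real k"
  shows "Re (trial_eigenvalue k \<zeta>) < 0" "- 80 / \<bar>Im (trial_eigenvalue k \<zeta>)\<bar> ^ 3 \<le> Re (trial_eigenvalue k \<zeta>)"
proof -
  define s where "s = Im (trial_eigenvalue k \<zeta>)"
  define a where "a = wave_number k \<zeta>"
  have K: "real k \<ge> 1" using k by simp
  have s: "s > 0" using Im K by (simp add: s_def)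
  have "a = of_real pi + \<zeta> / of_real ((real k)\<^sup>2)" by (simp add: a_def wave_number_def)
  then have Ra: "Re a = pi + Re \<zeta> / (real k)\<^sup>2" and Ia: "Im a = Im \<zeta> / (real k)\<^sup>2"
    by (simp_all only: plus_complex.sel Re_complex_of_real Im_complex_of_real Re_divide_of_real Im_divide_of_real add_0_left)
  have "1 \<le> (real k)\<^sup>2" using K by (simp add: one_le_power)
  then have "\<bar>Re \<zeta> / (real k)\<^sup>2\<bar> \<le> 1"
    using root_region_bounds(3)[OF \<zeta>] by (simp add: abs_divide divide_le_eq)
  then have Ra': "0 < Re a" "Re a \<le> 5" unfolding Ra using pi_gt3 pi_less_4 by linarith+
  have "0 < 1 / (2 * pi)" by simp
  then have "0 < Im \<zeta>" using root_region_bounds(1)[OF \<zeta>] by linarith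
  then have Ia0: "0 < Im a" using K by (simp add: Ia)
  have Ia1: "Im a \<le> 16 / s\<^sup>2"
  proof -
    have "s\<^sup>2 \<le> (4 * real k)\<^sup>2" using Im s by (intro power_mono) (simp_all add: s_def)
    then have "1 / (real k)\<^sup>2 \<le> 16 / s\<^sup>2" using s K by (simp add: field_simps power_mult_distrib)
    moreover have "Im a \<le> 1 / (real k)\<^sup>2"
      unfolding Ia using root_region_bounds(2)[OF \<zeta>] by (intro divide_right_mono) auto
    ultimately show ?thesis by linarith
  qed
  have "Im (a\<^sup>2 + (freq k)\<^sup>2) = Im (- (trial_eigenvalue k \<zeta>)\<^sup>2)" unfolding a_def wave_equation[OF k] ..
  moreover have "Im (w\<^sup>2) = 2 * Re w * Im w" for w by (simp add: power2_eq_square)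
  moreover have "Im ((freq k)\<^sup>2) = 0" by (simp add: freq_def power2_eq_square)
  ultimately have "2 * Re a * Im a = - (2 * Re (trial_eigenvalue k \<zeta>) * s)"
    by (simp only: plus_complex.sel uminus_complex.sel s_def)
  then have "Re a * Im a = - Re (trial_eigenvalue k \<zeta>) * s" by linarith
  then have eq: "Re (trial_eigenvalue k \<zeta>) = - (Re a * Im a) / s"
    using s by simp
  show "Re (trial_eigenvalue k \<zeta>) < 0" unfolding eq using Ra' Ia0 s by (simp add: divide_neg_pos)
  have "Re a * Im a \<le> 5 * (16 / s\<^sup>2)" using Ra' Ia0 Ia1 by (intro mult_mono) auto
  then have "Re a * Im a / s \<le> 5 * (16 / s\<^sup>2) / s" using s by (intro divide_right_mono) auto
  also have "\<dots> = 80 / s ^ 3" by (simp add: power2_eq_square power3_eq_cube)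
  finally show "- 80 / \<bar>Im (trial_eigenvalue k \<zeta>)\<bar> ^ 3 \<le> Re (trial_eigenvalue k \<zeta>)"
    unfolding eq using s by (simp add: s_def[symmetric])
qed

lemma characteristic_roots_exist:
  "\<forall>\<^sub>F k in sequentially. \<exists>\<zeta>\<in>root_region. characteristic_root k (trial_eigenvalue k \<zeta>) (wave_number k \<zeta>) (heat_number k \<zeta>)
     \<and> Im (trial_eigenvalue k \<zeta>) \<noteq> 0 \<and> - 80 / \<bar>Im (trial_eigenvalue k \<zeta>)\<bar> ^ 3 \<le> Re (trial_eigenvalue k \<zeta>) \<and> Re (trial_eigenvalue k \<zeta>) < 0"
  using eventually_nondegenerate eventually_fixmap_continuous eventually_fixmap_into eventually_ge_at_top[of "1 :: nat"]
proof eventually_elim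
  case (elim k)
  obtain \<zeta> where \<zeta>: "\<zeta> \<in> root_region" "fixmap k \<zeta> = \<zeta>"
  proof (rule brouwer_ball[OF _ elim(2,3)[unfolded root_region_def]])
    show "0 < 1 / (2 * pi)" by simp
  qed (auto simp: root_region_def)
  from elim(1) \<zeta>(1) have nd: "cos (heat_number k \<zeta>) \<noteq> 0" "sin (heat_number k \<zeta>) \<noteq> 0" "sin (wave_number k \<zeta> / 2) \<noteq> 0"
    "heat_number k \<zeta> \<noteq> 0" and Im: "3 * real k \<le> Im (trial_eigenvalue k \<zeta>)" "Im (trial_eigenvalue k \<zeta>) \<le> 4 * real k" by blast+
  have Im0: "Im (trial_eigenvalue k \<zeta>) \<noteq> 0" using Im(1) elim(4) by auto
  then have mu0: "trial_eigenvalue k \<zeta> \<noteq> 0" by auto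
  have "characteristic_root k (trial_eigenvalue k \<zeta>) (wave_number k \<zeta>) (heat_number k \<zeta>)"
    by (unfold_locales) (use elim(4) mu0 nd \<zeta> in \<open>simp_all add: wave_equation heat_equation fixmap_characteristic\<close>)
  with Im0 Re_trial_eigenvalue_bounds[OF elim(4) \<zeta>(1) Im] \<zeta>(1) show ?case by blast
qed

lemma frequently_le_Limsup:
  fixes f :: "'a \<Rightarrow> 'b::complete_linorder"
  assumes "frequently (\<lambda>x. c \<le> f x) F"
  shows "c \<le> Limsup F f"
  unfolding Limsup_def
proof (rule INF_greatest)
  fix P assume "P \<in> {P. eventually P F}"
  then have "frequently (\<lambda>x. c \<le> f x \<and> P x) F" using assms by (simp add: frequently_eventually_frequently)
  then obtain x where "c \<le> f x" "P x" using frequently_ex by blast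
  then show "c \<le> (SUP x\<in>{x. P x}. f x)" by (auto intro: SUP_upper2)
qed

theorem theorem3p3:
  shows "(\<exists>(lp :: nat \<Rightarrow> complex) (lm :: nat \<Rightarrow> complex) (C :: real). C > 0 \<and>
           (\<forall>k\<ge>1. A_eigenvalue (lp k) \<and> A_eigenvalue (lm k)) \<and>
           (\<lambda>k. Im (lp k) / (real k * pi)) \<longlonglongrightarrow> 1 \<and>
           (\<lambda>k. Im (lm k) / (- (real k * pi))) \<longlonglongrightarrow> 1 \<and>
           (\<forall>k\<ge>1. Im (lp k) \<noteq> 0 \<and> - C / \<bar>Im (lp k)\<bar> ^ 3 \<le> Re (lp k) \<and> Re (lp k) < 0 \<and>
                   Im (lm k) \<noteq> 0 \<and> - C / \<bar>Im (lm k)\<bar> ^ 3 \<le> Re (lm k) \<and> Re (lm k) < 0)) \<and>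
         Limsup at_infinity
           (\<lambda>s::real. opnorm (A_resolvent (\<i> * of_real s)) / ennreal (\<bar>s\<bar> ^ 3)) > 0"
proof -
  define good where "good k \<zeta> \<longleftrightarrow> \<zeta> \<in> root_region \<and> characteristic_root k (trial_eigenvalue k \<zeta>) (wave_number k \<zeta>) (heat_number k \<zeta>)
     \<and> Im (trial_eigenvalue k \<zeta>) \<noteq> 0 \<and> - 80 / \<bar>Im (trial_eigenvalue k \<zeta>)\<bar> ^ 3 \<le> Re (trial_eigenvalue k \<zeta>) \<and> Re (trial_eigenvalue k \<zeta>) < 0" for k \<zeta>
  obtain K where K: "\<And>k. k \<ge> K \<Longrightarrow> \<exists>\<zeta>. good k \<zeta>"
    using characteristic_roots_exist unfolding eventually_sequentially good_def by blast
  \<comment> \<open>the value 0 for small \<open>k\<close> keeps the sequence bounded, as the limit lemmas require\<close>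
  define z where "z k = (if k \<ge> K then SOME \<zeta>. good k \<zeta> else 0)" for k
  have z: "good k (z k)" if "k \<ge> K" for k
    using someI_ex[OF K[OF that]] that by (simp add: z_def)
  have bound: "cmod (z k) \<le> 2" for k
    using z[of k] root_region_bounds(4) by (cases "k \<ge> K") (auto simp: good_def z_def)
  \<comment> \<open>only a tail of the roots is available, so its first member is repeated at the beginning\<close>
  define lp where "lp k = trial_eigenvalue (max k K) (z (max k K))" for k
  have root: "characteristic_root (max k K) (lp k) (wave_number (max k K) (z (max k K))) (heat_number (max k K) (z (max k K)))"
    and est: "Im (lp k) \<noteq> 0" "- 80 / \<bar>Im (lp k)\<bar> ^ 3 \<le> Re (lp k)" "Re (lp k) < 0" for k
    using z[of "max k K"] by (simp_all add: good_def lp_def)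
  have lim: "(\<lambda>k. Im (lp k) / (real k * pi)) \<longlonglongrightarrow> 1"
  proof -
    have "(\<lambda>k. Im (trial_eigenvalue k (z k) / of_nat k) / pi) \<longlonglongrightarrow> Im (\<i> * of_real pi) / pi"
      by (intro tendsto_intros trial_eigenvalue_tendsto[OF bound]) simp
    then have "(\<lambda>k. Im (trial_eigenvalue k (z k) / of_nat k) / pi) \<longlonglongrightarrow> 1" by simp
    then show ?thesis
      by (rule Lim_transform_eventually) (auto simp: lp_def max_def intro: eventually_sequentiallyI[of K])
  qed
  have eig: "A_eigenvalue (lp k)" "A_eigenvalue (cnj (lp k))" for k
    using characteristic_root.is_A_eigenvalue[OF root] characteristic_root.is_A_eigenvalue[OF characteristic_root_cnj[OF root]]
    by auto
  have first: "\<exists>(lp :: nat \<Rightarrow> complex) (lm :: nat \<Rightarrow> complex) (C :: real). C > 0 \<and>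
           (\<forall>k\<ge>1. A_eigenvalue (lp k) \<and> A_eigenvalue (lm k)) \<and>
           (\<lambda>k. Im (lp k) / (real k * pi)) \<longlonglongrightarrow> 1 \<and>
           (\<lambda>k. Im (lm k) / (- (real k * pi))) \<longlonglongrightarrow> 1 \<and>
           (\<forall>k\<ge>1. Im (lp k) \<noteq> 0 \<and> - C / \<bar>Im (lp k)\<bar> ^ 3 \<le> Re (lp k) \<and> Re (lp k) < 0 \<and>
                   Im (lm k) \<noteq> 0 \<and> - C / \<bar>Im (lm k)\<bar> ^ 3 \<le> Re (lm k) \<and> Re (lm k) < 0)"
  proof (rule exI[of _ lp], rule exI[of _ "\<lambda>k. cnj (lp k)"], rule exI[of _ 80], intro conjI allI impI)
    show "(\<lambda>k. Im (cnj (lp k)) / (- (real k * pi))) \<longlonglongrightarrow> 1" using lim by simp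
  qed (simp_all add: eig lim est[simplified])
  define f where "f s = opnorm (A_resolvent (\<i> * of_real s)) / ennreal (\<bar>s\<bar> ^ 3)" for s :: real
  have f: "ennreal (1 / 80) \<le> f (Im (lp k))" for k
  proof -
    define s where "s = \<bar>Im (lp k)\<bar> ^ 3"
    have s: "s > 0" using est(1) by (simp add: s_def)
    have le: "\<bar>Re (lp k)\<bar> \<le> 80 / s" and pos: "\<bar>Re (lp k)\<bar> > 0" using est(2,3)[of k] by (simp_all add: s_def)
    have "1 / 80 * s \<le> 1 / r" if "r \<le> 80 / s" "r > 0" for r
      using that s by (simp add: field_simps)
    from this[OF le pos] have "ennreal (1 / 80) * ennreal s \<le> ennreal (1 / \<bar>Re (lp k)\<bar>)"
      using s by (simp only: ennreal_mult[symmetric] ennreal_leI)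
    also have "\<dots> \<le> opnorm (A_resolvent (\<i> * of_real (Im (lp k))))"
      using est(3)[of k] by (intro characteristic_root.opnorm_resolvent_ge[OF root]) simp
    finally have "ennreal (1 / 80) * ennreal s / ennreal s \<le> f (Im (lp k))"
      unfolding f_def s_def[symmetric] by (rule divide_right_mono_ennreal)
    then show ?thesis using s by (simp add: ennreal_mult_divide_eq)
  qed
  have "filterlim (\<lambda>k. pi * real k) at_top sequentially"
    by (rule filterlim_tendsto_pos_mult_at_top[OF tendsto_const pi_gt_zero filterlim_real_sequentially])
  then have "filterlim (\<lambda>k. Im (lp k) / (real k * pi) * (pi * real k)) at_top sequentially"
    by (rule filterlim_tendsto_pos_mult_at_top[OF lim zero_less_one])
  moreover have "\<forall>\<^sub>F k in sequentially. Im (lp k) / (real k * pi) * (pi * real k) = Im (lp k)"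
    by (rule eventually_sequentiallyI[of 1]) simp
  ultimately have "filterlim (\<lambda>k. Im (lp k)) at_top sequentially"
    by (simp only: filterlim_cong[OF refl refl])
  then have inf: "filterlim (\<lambda>k. Im (lp k)) at_infinity sequentially"
    by (rule filterlim_at_top_imp_at_infinity)
  have "frequently (\<lambda>s. ennreal (1 / 80) \<le> f s) at_infinity"
    unfolding frequently_def
  proof
    assume "\<forall>\<^sub>F s in at_infinity. \<not> ennreal (1 / 80) \<le> f s"
    from eventually_compose_filterlim[OF this inf] f show False by simp
  qed
  then have "ennreal (1 / 80) \<le> Limsup at_infinity f" by (rule frequently_le_Limsup)
  then have "0 < Limsup at_infinity f" by (rule less_le_trans[rotated]) simp
  with first show ?thesis unfolding f_def by blast
qed

end
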